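(* Let $F(p)={}_2F_1(\tfrac16,\tfrac56;1;-p)=P_{-1/6}(1+2p)$ and $h(x)=\int_0^\infty\mathrm{e}^{-px}F(p)\,dp$ for $\Re x>0$. Then $$h(x)=\frac{F(0)}{x}-\sum_{m=2}^{\infty}\frac{(-1)^{m}\,\Gamma(m)}{2\pi\,(x)_{m}}\,d_m-\sum_{k=1}^{\infty}\mathrm{e}^{2^{-k}}\sum_{m=2}^{\infty}\frac{\Gamma(m)}{2\pi\,(2^kx)_{m}}\,d_{km},$$ where $$d_m=\int_0^{\infty}\frac{F(t)\,\mathrm{e}^{t+1}}{(\mathrm{e}^{t+1}-1)^{m}}\,dt,\qquad d_{km}=\int_0^{\infty}\frac{\mathrm{e}^{2^{-k}t}F(t)}{(\mathrm{e}^{2^{-k}(1+t)}+1)^{m}}\,dt .$$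
   Context: $(z)_m=z(z+1)\cdots(z+m-1)$ is the rising factorial; $P_\nu$ is the Legendre function; $F$ is taken on its first Riemann sheet, analytic in $\mathbb{C}\setminus(-\infty,-1]$. The function $h$ is the normalized Airy function: $x^{5/4}\mathrm{e}^{-\frac23x^{3/2}}h(\tfrac43x^{3/2})$ is a constant multiple of $\mathrm{Ai}(x)$ for $x>0$. *)

theory Defs
  imports "HOL-Complex_Analysis.Complex_Analysis"
begin

(* Principal branch: the analytic continuation of the hypergeometric series at 0 to the plane
   cut along [1,\<infinity>). By the identity theorem it is unique off the cut; values on the cut are
   unspecified. Meant for c not in {0,-1,-2,...}. *)
definition hyp2F1 :: "complex \<Rightarrow> complex \<Rightarrow> complex \<Rightarrow> complex \<Rightarrow> complex" where
  "hyp2F1 a b c = (SOME f. f analytic_on - (complex_of_real ` {1..}) \<and>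
                           f has_fps_expansion fps_hypergeo [a, b] [c] 1)"

definition legendre_P :: "complex \<Rightarrow> complex \<Rightarrow> complex" where
  "legendre_P \<nu> z = hyp2F1 (- \<nu>) (\<nu> + 1) 1 ((1 - z) / 2)"

definition F :: "complex \<Rightarrow> complex" where
  "F p = hyp2F1 (1/6) (5/6) 1 (- p)"

definition h_integrand :: "complex \<Rightarrow> real \<Rightarrow> complex" where
  "h_integrand x p = exp (- of_real p * x) * F (of_real p)"

definition h :: "complex \<Rightarrow> complex" where
  "h x = (LINT p:{0..}|lborel. h_integrand x p)"

definition d_integrand :: "nat \<Rightarrow> real \<Rightarrow> complex" where
  "d_integrand m t = F (of_real t) * of_real (exp (t + 1)) / of_real ((exp (t + 1) - 1) ^ m)"

definition d :: "nat \<Rightarrow> complex" where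
  "d m = (LINT t:{0..}|lborel. d_integrand m t)"

definition dyadic_d_integrand :: "nat \<Rightarrow> nat \<Rightarrow> real \<Rightarrow> complex" where
  "dyadic_d_integrand k m t =
     of_real (exp (t / 2 ^ k)) * F (of_real t) / of_real ((exp ((1 + t) / 2 ^ k) + 1) ^ m)"

definition dyadic_d :: "nat \<Rightarrow> nat \<Rightarrow> complex" where
  "dyadic_d k m = (LINT t:{0..}|lborel. dyadic_d_integrand k m t)"

end

theory Submission
  imports Defs
begin

text \<open>Write \<open>F\<close> as Euler's integral. Its moments on the half-line, computed by Gauss' theorem, show
  that \<open>F\<close> reproduces itself under the Stieltjes transform:
  \<open>2 \<pi> F(p) = \<integral> F(t) / (1 + t + p) dt\<close> over \<open>t \<ge> 0\<close>. For \<open>y = 1 + t + p\<close> insert the telescoping identity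
  \<open>1 / y = 1 / (e\<^sup>y - 1) + \<Sum>k\<ge>1. 2\<^sup>-\<^sup>k / (exp (y / 2\<^sup>k) + 1)\<close> and integrate against \<open>exp (- p x)\<close>.
  Every summand, expanded geometrically in powers of \<open>1 - exp (- p / 2\<^sup>k)\<close>, yields a factorial series,
  because \<open>\<integral> exp (- q X) (1 - e\<^sup>-\<^sup>q)\<^sup>j dq = j! / (X)\<^sub>j\<^sub>+\<^sub>1\<close>. The terms \<open>m = 1\<close> recombine, by the same
  identity, to \<open>F(0) / x\<close>.\<close>

section \<open>Preliminaries\<close>

text \<open>Why \<open>1 / y\<close> is split dyadically: expanding
  \<open>1 / (L exp q - \<epsilon>)\<close> in powers of \<open>1 - exp (- q)\<close> is a geometric
  series of ratio at most \<open>1 / (L - \<epsilon>)\<close>. With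
  \<open>L = exp ((1 + t) / l)\<close> and \<open>\<epsilon> = 1\<close> this is below 1 for
  \<open>l = 1\<close>, because \<open>exp 1 - 1 > 1\<close>; here the leading 1 of
  \<open>1 + t + p\<close>, the distance from the origin to the singularity at
  \<open>p = -1\<close>, is essential. For large \<open>l\<close> it fails near
  \<open>t = 0\<close>. The telescoping passes from \<open>l = 1\<close> to the limit
  \<open>1 / y\<close> through kernels with \<open>\<epsilon> = -1\<close> only, whose denominators
  \<open>L + 1\<close> exceed 2 at every scale. The exchanges of limits rest on one integrability
  fact, that \<open>F t / (1 + t)\<close> is integrable: every kernel and every partial sum of the
  decomposition lies between 0 and \<open>1 / y\<close>. The series argument sees \<open>F\<close>
  only as the Stieltjes transform of a positive measure, and the transform identity holds for all
  \<open>\<^sub>2F\<^sub>1(a, 1 - a; 1; - p)\<close> with \<open>0 < a < 1\<close>. The constant is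
  then \<open>Gamma a * Gamma (1 - a) = pi / sin (pi a)\<close>, which is \<open>2 pi\<close> at
  \<open>a = 1 / 6\<close>.\<close>

lemma has_field_derivative_integral:
  fixes K K' :: "complex \<Rightarrow> 'a \<Rightarrow> complex" and g :: "'a \<Rightarrow> real"
  assumes r: "r > 0"
    and int: "\<And>z. z \<in> ball z0 r \<Longrightarrow> integrable M (K z)"
    and K': "K' z0 \<in> borel_measurable M"
    and deriv: "AE t in M. \<forall>z\<in>ball z0 r. ((\<lambda>z. K z t) has_field_derivative K' z t) (at z)"
    and bound: "AE t in M. \<forall>z\<in>ball z0 r. norm (K' z t) \<le> g t"
    and g: "integrable M g"
  shows "((\<lambda>z. \<integral>t. K z t \<partial>M) has_field_derivative (\<integral>t. K' z0 t \<partial>M)) (at z0)"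
proof -
  have z0: "z0 \<in> ball z0 r" using r by simp
  have "((\<lambda>z. ((\<integral>t. K z t \<partial>M) - (\<integral>t. K z0 t \<partial>M)) / (z - z0)) \<longlongrightarrow> (\<integral>t. K' z0 t \<partial>M))
          (at z0 within ball z0 r)"
    unfolding tendsto_at_iff_sequentially comp_def
  proof (intro allI impI)
    fix X :: "nat \<Rightarrow> complex"
    assume X: "\<forall>i. X i \<in> ball z0 r - {z0}" and lim: "X \<longlonglongrightarrow> z0"
    have "(\<lambda>i. \<integral>t. (K (X i) t - K z0 t) / (X i - z0) \<partial>M) \<longlonglongrightarrow> (\<integral>t. K' z0 t \<partial>M)"
    proof (rule integral_dominated_convergence[where w=g])
      show "(\<lambda>t. (K (X i) t - K z0 t) / (X i - z0)) \<in> borel_measurable M" for i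
        using int[of "X i"] int[OF z0] X by (auto intro!: borel_measurable_divide borel_measurable_diff)
      show "AE t in M. (\<lambda>i. (K (X i) t - K z0 t) / (X i - z0)) \<longlonglongrightarrow> K' z0 t"
        using deriv
      proof eventually_elim
        case (elim t)
        then have "((\<lambda>z. K z t) has_field_derivative K' z0 t) (at z0 within ball z0 r)"
          using z0 has_field_derivative_at_within by blast
        then show ?case
          using X lim by (auto simp: has_field_derivative_iff tendsto_at_iff_sequentially comp_def)
      qed
      show "AE t in M. norm ((K (X i) t - K z0 t) / (X i - z0)) \<le> g t" for i
        using deriv bound
      proof eventually_elim
        case (elim t)
        \<comment> \<open>Mean value inequality on the convex ball: the bound \<open>g\<close> for
          the derivative also bounds every difference quotient.\<close>
        have "norm (K (X i) t - K z0 t) \<le> g t * norm (X i - z0)"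
          by (rule field_differentiable_bound[where S="ball z0 r" and f'="\<lambda>z. K' z t"])
             (use elim X z0 in \<open>auto intro: has_field_derivative_at_within\<close>)
        then show ?case
          using X by (simp add: norm_divide divide_le_eq)
      qed
    qed (use K' g in auto)
    moreover have "(\<integral>t. (K (X i) t - K z0 t) / (X i - z0) \<partial>M) =
        ((\<integral>t. K (X i) t \<partial>M) - (\<integral>t. K z0 t \<partial>M)) / (X i - z0)" for i
      using int[of "X i"] int[OF z0] X
      by (metis Bochner_Integration.integral_diff DiffD1 integral_divide_zero)
    ultimately show "(\<lambda>i. ((\<integral>t. K (X i) t \<partial>M) - (\<integral>t. K z0 t \<partial>M)) / (X i - z0)) \<longlonglongrightarrow> (\<integral>t. K' z0 t \<partial>M)"
      by (simp only:)
  qed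
  then show ?thesis
    using at_within_open[OF z0] by (simp add: has_field_derivative_iff)
qed

lemma powr_minus_binomial_complex:
  fixes z a :: complex
  assumes "norm z < 1"
  shows "(\<lambda>k. pochhammer a k / fact k * z ^ k) sums (1 - z) powr (- a)"
proof -
  have "(\<lambda>k. (- a gchoose k) * (- z) ^ k) sums (1 + - z) powr (- a)"
    using assms by (intro gen_binomial_complex) simp
  moreover have "(- a gchoose k) * (- z) ^ k = pochhammer a k / fact k * z ^ k" for k
    by (simp add: gbinomial_pochhammer mult_ac flip: power_mult_distrib)
  ultimately show ?thesis by simp
qed

lemma powr_minus_binomial_real:
  fixes z a :: real
  assumes "\<bar>z\<bar> < 1"
  shows "(\<lambda>k. pochhammer a k / fact k * z ^ k) sums (1 - z) powr (- a)"
proof -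
  have "(\<lambda>k. (- a gchoose k) * (- z) ^ k) sums (1 + - z) powr (- a)"
    using assms by (intro gen_binomial_real) simp
  moreover have "(- a gchoose k) * (- z) ^ k = pochhammer a k / fact k * z ^ k" for k
    by (simp add: gbinomial_pochhammer mult_ac flip: power_mult_distrib)
  ultimately show ?thesis by simp
qed

lemma Gamma_add_nat:
  fixes a :: real
  assumes "a > 0"
  shows "Gamma (a + of_nat n) = pochhammer a n * Gamma a"
proof -
  have "a \<notin> \<int>\<^sub>\<le>\<^sub>0"
    using nonpos_Ints_nonpos[of a] assms by auto
  then show ?thesis
    using pochhammer_Gamma[of a n] Gamma_real_pos[OF assms] by (simp add: less_imp_neq[symmetric])
qed

text \<open>Induction step shared by two integral evaluations below: inserting a factor
  \<open>t / (1 + t) = 1 - 1 / (1 + t)\<close>, or \<open>1 - exp (- p)\<close>, replaces an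
  integral with parameter \<open>s\<close> by its difference with the one at
  \<open>s + 1\<close>.\<close>

lemma pochhammer_reciprocal_diff:
  fixes s :: "'a :: field_char_0"
  assumes "\<And>j::nat. s + of_nat j \<noteq> 0"
  shows "fact k / pochhammer s (Suc k) - fact k / pochhammer (s + 1) (Suc k) =
           fact (Suc k) / pochhammer s (Suc (Suc k))"
proof -
  have P: "pochhammer (s + 1) k \<noteq> 0"
  proof
    assume "pochhammer (s + 1) k = 0"
    then obtain j where "s + 1 = - of_nat j" by (auto simp: pochhammer_eq_0_iff)
    then have "s + of_nat (Suc j) = 0" by (simp add: add.assoc[symmetric])
    then show False using assms by blast
  qed
  have 1: "pochhammer s (Suc k) = s * pochhammer (s + 1) k"
    by (rule pochhammer_rec)
  have 2: "pochhammer (s + 1) (Suc k) = pochhammer (s + 1) k * (s + 1 + of_nat k)"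
    by (rule pochhammer_Suc)
  have 3: "pochhammer s (Suc (Suc k)) = s * (pochhammer (s + 1) k * (s + 1 + of_nat k))"
    using pochhammer_rec[of s "Suc k"] 2 by simp
  have nz: "s \<noteq> 0" "s + 1 + of_nat k \<noteq> 0" using assms[of 0] assms[of "Suc k"] by (simp_all add: algebra_simps)
  \<comment> \<open>The factor \<open>k + 1\<close> is the difference of the last and first factors
    of \<open>pochhammer s (k + 2)\<close>, which is the partial fraction wanted.\<close>
  have "fact (Suc k) = ((s + 1 + of_nat k) - s) * fact k"
    by simp
  then show ?thesis
    unfolding 1 2 3 using P nz by (simp only:) (simp add: divide_simps, simp add: algebra_simps)
qed

section \<open>Euler's integral\<close>

text \<open>The generalised arcsine law, in terms of which Euler's integral reads
  \<open>\<^sub>2F\<^sub>1(a, 1 - a; 1; z) = \<integral> (1 - z u) powr (- a) d(arcsine_law a)(u)\<close>.\<close>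

definition arcsine_law :: "real \<Rightarrow> real measure" where
  "arcsine_law a = density lborel
     (\<lambda>u. ennreal (indicator {0..1} u * (u powr (- a) * (1 - u) powr (a - 1)) / Beta (1 - a) a))"

lemma sets_arcsine_law [measurable_cong, simp]: "sets (arcsine_law a) = sets borel"
  and space_arcsine_law [simp]: "space (arcsine_law a) = UNIV"
  by (simp_all add: arcsine_law_def)

lemma AE_arcsine_law: "AE u in arcsine_law a. 0 \<le> u \<and> u \<le> 1"
  unfolding arcsine_law_def
  by (subst AE_density) (auto split: split_indicator_asm intro!: AE_I2)

lemma Beta_real_pos: "a > 0 \<Longrightarrow> b > 0 \<Longrightarrow> Beta a b > (0::real)"
  unfolding Beta_def by (intro divide_pos_pos mult_pos_pos Gamma_real_pos) auto

lemma nn_integral_Beta: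
  fixes a b :: real
  assumes "a > 0" "b > 0"
  shows "(\<integral>\<^sup>+u. ennreal (indicator {0..1} u * (u powr (a - 1) * (1 - u) powr (b - 1))) \<partial>lborel)
           = ennreal (Beta a b)"
  using nn_integral_has_integral_lebesgue[OF _ has_integral_Beta_real[OF assms]] by simp

lemma nn_integral_arcsine_law_moment:
  assumes a: "0 < a" "a < 1"
  shows "(\<integral>\<^sup>+u. ennreal (u ^ i * (1 - u) ^ j) \<partial>arcsine_law a) =
           ennreal (Beta (1 - a + real i) (a + real j) / Beta (1 - a) a)"
proof -
  let ?B = "Beta (1 - a) a"
  have B: "?B > 0" using a by (intro Beta_real_pos) auto
  have "(\<integral>\<^sup>+u. ennreal (u ^ i * (1 - u) ^ j) \<partial>arcsine_law a) =
     (\<integral>\<^sup>+u. ennreal (indicator {0..1} u * (u powr (- a) * (1 - u) powr (a - 1)) / ?B) *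
        ennreal (u ^ i * (1 - u) ^ j) \<partial>lborel)"
    unfolding arcsine_law_def by (subst nn_integral_density) auto
  also have "\<dots> = (\<integral>\<^sup>+u. ennreal (1 / ?B) * ennreal (indicator {0..1} u *
      (u powr ((1 - a + real i) - 1) * (1 - u) powr ((a + real j) - 1))) \<partial>lborel)"
  proof (rule nn_integral_cong)
    fix u :: real
    show "ennreal (indicator {0..1} u * (u powr (- a) * (1 - u) powr (a - 1)) / ?B) *
        ennreal (u ^ i * (1 - u) ^ j) = ennreal (1 / ?B) * ennreal (indicator {0..1} u *
      (u powr ((1 - a + real i) - 1) * (1 - u) powr ((a + real j) - 1)))"
    proof (cases "u \<in> {0..1}")
      case True
      \<comment> \<open>At the endpoints both sides vanish, since \<open>0 powr _ = 0\<close> even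
        for negative exponents.\<close>
      have "u powr ((1 - a + real i) - 1) = u powr (- a) * u ^ i"
        using True powr_add[of u "-a" "real i"] powr_realpow[of u i] by (cases "u = 0") auto
      moreover have "(1 - u) powr ((a + real j) - 1) = (1 - u) powr (a - 1) * (1 - u) ^ j"
        using True powr_add[of "1 - u" "a - 1" "real j"] powr_realpow[of "1 - u" j]
        by (cases "u = 1") (auto simp: algebra_simps)
      ultimately show ?thesis
        using True B by (simp add: mult_ac flip: ennreal_mult'')
    qed (use B in \<open>simp flip: ennreal_mult\<close>)
  qed
  also have "\<dots> = ennreal (1 / ?B) * ennreal (Beta (1 - a + real i) (a + real j))"
    using a by (subst nn_integral_cmult, measurable, subst nn_integral_Beta) auto
  also have "\<dots> = ennreal (Beta (1 - a + real i) (a + real j) / ?B)"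
    using B a Beta_real_pos[of "1 - a + real i" "a + real j"]
    by (simp flip: ennreal_mult)
  finally show ?thesis .
qed

lemma emeasure_arcsine_law:
  assumes "0 < a" "a < 1"
  shows "emeasure (arcsine_law a) UNIV = 1"
proof -
  have "Beta (1 - a) a > 0" using assms by (intro Beta_real_pos) auto
  then show ?thesis
    using nn_integral_arcsine_law_moment[OF assms, of 0 0] by simp
qed

text \<open>The Beta parameters add up to \<open>1 + n\<close>, so each quotient has denominator
  \<open>n!\<close> and its Gamma factors collapse to one Pochhammer symbol. Powers of
  \<open>u\<close> give the Taylor series at 0, powers of \<open>1 - u\<close> the Pfaff-transformed
  series.\<close>

lemma arcsine_law_moments:
  assumes a: "0 < a" "a < 1"
  shows "(\<integral>\<^sup>+u. ennreal (u ^ n) \<partial>arcsine_law a) = ennreal (pochhammer (1 - a) n / fact n)"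
    and "(\<integral>\<^sup>+u. ennreal ((1 - u) ^ n) \<partial>arcsine_law a) = ennreal (pochhammer a n / fact n)"
proof -
  have G: "Gamma a \<noteq> 0" "Gamma (1 - a) \<noteq> 0"
    using a by (simp_all add: Gamma_real_pos less_imp_neq[symmetric])
  have F: "Gamma (1 + real n) = fact n" by (simp add: Gamma_fact)
  have "Beta (1 - a + real n) a / Beta (1 - a) a = pochhammer (1 - a) n / fact n"
    using G a Gamma_add_nat[of "1 - a" n] F by (simp add: Beta_def algebra_simps)
  then show "(\<integral>\<^sup>+u. ennreal (u ^ n) \<partial>arcsine_law a) = ennreal (pochhammer (1 - a) n / fact n)"
    using nn_integral_arcsine_law_moment[OF a, of n 0] by simp
  have "Beta (1 - a) (a + real n) / Beta (1 - a) a = pochhammer a n / fact n"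
    using G a Gamma_add_nat[of a n] F by (simp add: Beta_def algebra_simps)
  then show "(\<integral>\<^sup>+u. ennreal ((1 - u) ^ n) \<partial>arcsine_law a) = ennreal (pochhammer a n / fact n)"
    using nn_integral_arcsine_law_moment[OF a, of 0 n] by simp
qed

text \<open>\<open>Ln\<close> is continuous only off the closed slit of nonpositive reals; on the
  slit it equals \<open>ln (norm z) + \<i> pi\<close> except at 0. The two pieces are glued.\<close>

lemma borel_measurable_Ln_complex: "(Ln :: complex \<Rightarrow> complex) \<in> borel_measurable borel"
proof -
  have neg: "Ln z = (if z = 0 then Ln 0 else of_real (ln (norm z)) + \<i> * of_real pi)"
    if "z \<in> \<real>\<^sub>\<le>\<^sub>0" for z :: complex
  proof -
    from that obtain r where "z = of_real r" "r \<le> 0" by (auto elim: nonpos_Reals_cases)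
    then show ?thesis using Ln_of_real'[of r] by (cases "r = 0") auto
  qed
  have "(\<lambda>z :: complex. if z \<in> \<real>\<^sub>\<le>\<^sub>0 then Ln z else Ln z) \<in> borel_measurable borel"
  proof (rule measurable_If_restrict_space_iff[THEN iffD2], safe)
    show "{x \<in> space borel. (x::complex) \<in> \<real>\<^sub>\<le>\<^sub>0} \<in> sets borel"
      by simp
    have "(\<lambda>z::complex. if z = 0 then Ln 0 else of_real (ln (norm z)) + \<i> * of_real pi)
            \<in> restrict_space borel {x. x \<in> \<real>\<^sub>\<le>\<^sub>0} \<rightarrow>\<^sub>M borel"
      by (intro measurable_restrict_space1) measurable
    then show "(Ln :: complex \<Rightarrow> complex) \<in> restrict_space borel {x. x \<in> \<real>\<^sub>\<le>\<^sub>0} \<rightarrow>\<^sub>M borel"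
      by (rule measurable_cong[THEN iffD1, rotated]) (auto simp: space_restrict_space neg)
    show "(Ln :: complex \<Rightarrow> complex) \<in> restrict_space borel {x. x \<notin> \<real>\<^sub>\<le>\<^sub>0} \<rightarrow>\<^sub>M borel"
      by (intro borel_measurable_continuous_on_restrict continuous_on_Ln continuous_on_id) auto
  qed
  then show ?thesis by simp
qed

lemma borel_measurable_powr_complex [measurable (raw)]:
  fixes f g :: "'a \<Rightarrow> complex"
  assumes [measurable]: "f \<in> borel_measurable M" "g \<in> borel_measurable M"
  shows "(\<lambda>x. f x powr g x) \<in> borel_measurable M"
proof -
  note [measurable] = borel_measurable_Ln_complex
  show ?thesis unfolding powr_def by measurable
qed

section \<open>Holomorphy and power series of Euler's integral\<close>

definition euler_integral :: "real \<Rightarrow> complex \<Rightarrow> complex" where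
  "euler_integral a z = (\<integral>u. (1 - z * of_real u) powr (- of_real a) \<partial>arcsine_law a)"

lemma open_slit_plane: "open (- (complex_of_real ` {1..}))"
  by (intro open_Compl closed_injective_linear_image linear_of_real)
     (auto simp: inj_on_def)

text \<open>If \<open>1 - z u = r\<close> with \<open>r \<le> 0\<close>, then
  \<open>z = (1 - r) / u\<close> would lie on the cut. So the principal power in Euler's integral
  stays off its own branch cut.\<close>

lemma one_minus_notin_nonpos_Reals:
  assumes "z \<notin> complex_of_real ` {1..}" "0 \<le> u" "u \<le> 1"
  shows "1 - z * of_real u \<notin> \<real>\<^sub>\<le>\<^sub>0"
proof
  assume "1 - z * of_real u \<in> \<real>\<^sub>\<le>\<^sub>0"
  then obtain r where r: "1 - z * of_real u = of_real r" "r \<le> 0" by (auto elim: nonpos_Reals_cases)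
  then have u: "u \<noteq> 0" by auto
  from r have "z * of_real u = of_real (1 - r)" by (simp add: algebra_simps)
  then have "z = of_real ((1 - r) / u)" using u by (simp add: field_simps)
  moreover have "(1 - r) / u \<ge> 1" using r u assms by (simp add: field_simps)
  ultimately show False using assms by blast
qed

lemma finite_measure_arcsine_law:
  assumes "0 < a" "a < 1"
  shows "finite_measure (arcsine_law a)"
  by standard (simp add: emeasure_arcsine_law[OF assms])

lemma integrable_arcsine_law:
  fixes f :: "real \<Rightarrow> 'b::{banach,second_countable_topology}"
  assumes a: "0 < a" "a < 1" and "f \<in> borel_measurable borel"
    and "\<And>u. 0 \<le> u \<Longrightarrow> u \<le> 1 \<Longrightarrow> norm (f u) \<le> B"
  shows "integrable (arcsine_law a) f"
proof (rule finite_measure.integrable_const_bound[OF finite_measure_arcsine_law[OF a]])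
  show "AE u in arcsine_law a. norm (f u) \<le> B"
    using AE_arcsine_law by eventually_elim (use assms in auto)
qed (use assms in simp)

text \<open>Differentiation under the integral; compactness of
  \<open>cball z0 r \<times> {0..1}\<close> supplies the bounds. They are proved for an arbitrary
  exponent because both \<open>- a\<close> (the integrand) and \<open>- a - 1\<close> (its
  derivative) occur.\<close>

lemma euler_integral_holomorphic:
  assumes a: "0 < a" "a < 1"
  shows "euler_integral a holomorphic_on - (complex_of_real ` {1..})"
proof (rule holomorphic_onI)
  fix z0 assume z0: "z0 \<in> - (complex_of_real ` {1..})"
  then obtain r where r: "r > 0" "cball z0 r \<subseteq> - (complex_of_real ` {1..})"
    using open_slit_plane open_contains_cball by blast
  have cont: "continuous_on (cball z0 r \<times> {0..1}) (\<lambda>(z, u). (1 - z * of_real u) powr s)" for s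
  proof -
    have *: "1 - fst zu * complex_of_real (snd zu) \<notin> \<real>\<^sub>\<le>\<^sub>0" if "zu \<in> cball z0 r \<times> {0..1}" for zu
      using r that one_minus_notin_nonpos_Reals[of "fst zu" "snd zu"] by auto
    have "continuous_on (cball z0 r \<times> {0..1}) (\<lambda>zu. exp (s * Ln (1 - fst zu * of_real (snd zu))))"
      by (intro continuous_intros) (use * in auto)
    then show ?thesis
      by (rule continuous_on_cong[THEN iffD1, OF refl, rotated])
         (use * in \<open>force simp: powr_def case_prod_unfold\<close>)
  qed
  have "\<exists>B. \<forall>z\<in>cball z0 r. \<forall>u\<in>{0..1}. norm ((1 - z * of_real u) powr s) \<le> B" for s
  proof -
    have "compact ((\<lambda>(z, u). (1 - z * complex_of_real u) powr s) ` (cball z0 r \<times> {0..1}))"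
      by (intro compact_continuous_image cont compact_Times) auto
    then show ?thesis
      by (fastforce dest!: compact_imp_bounded simp: bounded_iff)
  qed
  then obtain B where B: "\<And>s z u. z \<in> cball z0 r \<Longrightarrow> u \<in> {0..1} \<Longrightarrow>
      norm ((1 - z * of_real u) powr s) \<le> B s"
    by metis
  have "((\<lambda>z. \<integral>u. (1 - z * of_real u) powr (- of_real a) \<partial>arcsine_law a) has_field_derivative
          (\<integral>u. of_real a * of_real u * (1 - z0 * of_real u) powr (- of_real a - 1) \<partial>arcsine_law a)) (at z0)"
  proof (rule has_field_derivative_integral[OF r(1)])
    show "integrable (arcsine_law a) (\<lambda>u. (1 - z * of_real u) powr (- of_real a))"
      if "z \<in> ball z0 r" for z
      using that B[of z _ "- of_real a"]
      by (intro integrable_arcsine_law[OF a, where B="B (- of_real a)"]) auto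
    show "(\<lambda>u. of_real a * of_real u * (1 - z0 * of_real u) powr (- of_real a - 1))
            \<in> borel_measurable (arcsine_law a)"
      by measurable
    show "AE u in arcsine_law a. \<forall>z\<in>ball z0 r.
        ((\<lambda>z. (1 - z * of_real u) powr (- of_real a)) has_field_derivative
          of_real a * of_real u * (1 - z * of_real u) powr (- of_real a - 1)) (at z)"
      using AE_arcsine_law
    proof eventually_elim
      case (elim u)
      show ?case
      proof
        fix z assume "z \<in> ball z0 r"
        then have "1 - z * of_real u \<notin> \<real>\<^sub>\<le>\<^sub>0"
          using elim r(2) ball_subset_cball[of z0 r] by (intro one_minus_notin_nonpos_Reals) blast+
        then show "((\<lambda>z. (1 - z * of_real u) powr (- of_real a)) has_field_derivative
          of_real a * of_real u * (1 - z * of_real u) powr (- of_real a - 1)) (at z)"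
          by (auto intro!: derivative_eq_intros)
      qed
    qed
    show "AE u in arcsine_law a. \<forall>z\<in>ball z0 r.
        norm (of_real a * of_real u * (1 - z * of_real u) powr (- of_real a - 1)) \<le>
          B (- of_real a - 1)"
      using AE_arcsine_law
    proof eventually_elim
      case (elim u)
      have "a * u \<le> 1 * 1" using a elim by (intro mult_mono) auto
      then have "a * u * norm ((1 - z * of_real u) powr (- of_real a - 1)) \<le> 1 * B (- of_real a - 1)"
        if "z \<in> ball z0 r" for z
        using elim that by (intro mult_mono B) auto
      then show ?case using a elim by (simp add: norm_mult)
    qed
    show "integrable (arcsine_law a) (\<lambda>u. B (- of_real a - 1))"
      by (rule integrable_arcsine_law[OF a]) auto
  qed
  then have "(euler_integral a has_field_derivative
      (\<integral>u. of_real a * of_real u * (1 - z0 * of_real u) powr (- of_real a - 1) \<partial>arcsine_law a)) (at z0)"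
    by (simp add: euler_integral_def[abs_def])
  then show "euler_integral a field_differentiable at z0 within - (complex_of_real ` {1..})"
    using field_differentiable_at_within field_differentiable_def by blast
qed

text \<open>The binomial series of the integrand is integrated term by term, with the binomial
  series at \<open>norm z\<close> as majorant; the moments of the arcsine law supply the second
  Pochhammer factor.\<close>

lemma euler_integral_sums:
  assumes a: "0 < a" "a < 1" and z: "norm z < 1"
  shows "(\<lambda>n. of_real (pochhammer a n * pochhammer (1 - a) n / (fact n)\<^sup>2) * z ^ n) sums euler_integral a z"
proof -
  let ?f = "\<lambda>n u. of_real (pochhammer a n / fact n) * (z * complex_of_real u) ^ n"
  have pos: "pochhammer a n > 0" for n using a by (intro pochhammer_pos) auto
  have nf: "norm (?f n u) = pochhammer a n / fact n * (norm z) ^ n * \<bar>u\<bar> ^ n" for n u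
    using pos[of n] by (simp add: norm_mult norm_power norm_divide power_mult_distrib)
  have nf_le: "norm (?f n u) \<le> pochhammer a n / fact n * (norm z) ^ n" if "0 \<le> u" "u \<le> 1" for n u
  proof -
    have "pochhammer a n / fact n * (norm z) ^ n * \<bar>u\<bar> ^ n \<le> pochhammer a n / fact n * (norm z) ^ n * 1"
      using pos[of n] that by (intro mult_left_mono power_le_one) (auto simp: less_imp_le)
    then show ?thesis using nf by simp
  qed
  have S: "summable (\<lambda>n. pochhammer a n / fact n * (norm z) ^ n)"
    using powr_minus_binomial_real[of "norm z" a] z by (auto simp: sums_iff)
  have int: "integrable (arcsine_law a) (?f n)" for n
    by (rule integrable_arcsine_law[OF a, where B="pochhammer a n / fact n * (norm z) ^ n"])
       (use nf_le in auto)
  have mom: "(\<integral>u. u ^ n \<partial>arcsine_law a) = pochhammer (1 - a) n / fact n" for n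
  proof (rule integral_eq_nn_integral[THEN trans])
    show "AE u in arcsine_law a. 0 \<le> u ^ n" using AE_arcsine_law by eventually_elim auto
    show "enn2real (\<integral>\<^sup>+ x. ennreal (x ^ n) \<partial>arcsine_law a) = pochhammer (1 - a) n / fact n"
      using arcsine_law_moments(1)[OF a] pochhammer_pos[of "1 - a" n] a
      by (simp add: less_imp_le)
  qed simp
  have "(\<lambda>n. \<integral>u. ?f n u \<partial>arcsine_law a) sums (\<integral>u. (\<Sum>n. ?f n u) \<partial>arcsine_law a)"
  proof (rule sums_integral[OF int])
    show "AE u in arcsine_law a. summable (\<lambda>i. norm (?f i u))"
      using AE_arcsine_law
      by eventually_elim (rule summable_comparison_test'[OF S, of 0], use nf_le in auto)
    show "summable (\<lambda>i. \<integral>u. norm (?f i u) \<partial>arcsine_law a)"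
    proof (rule summable_comparison_test'[OF S, of 0])
      fix n
      have "(\<integral>u. norm (?f n u) \<partial>arcsine_law a) \<le>
            (\<integral>u. pochhammer a n / fact n * (norm z) ^ n \<partial>arcsine_law a)"
      proof (rule integral_mono_AE)
        show "AE u in arcsine_law a. norm (?f n u) \<le> pochhammer a n / fact n * (norm z) ^ n"
          using AE_arcsine_law by eventually_elim (use nf_le in auto)
        show "integrable (arcsine_law a) (\<lambda>u. pochhammer a n / fact n * (norm z) ^ n)"
          by (rule integrable_arcsine_law[OF a]) auto
      qed (use int in \<open>simp\<close>)
      also have "\<dots> = pochhammer a n / fact n * (norm z) ^ n"
        using emeasure_arcsine_law[OF a] by (simp add: measure_def)
      finally show "norm (\<integral>u. norm (?f n u) \<partial>arcsine_law a) \<le> pochhammer a n / fact n * (norm z) ^ n"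
        by (simp add: Bochner_Integration.integral_nonneg)
    qed
  qed
  also have "(\<integral>u. (\<Sum>n. ?f n u) \<partial>arcsine_law a) = euler_integral a z"
    unfolding euler_integral_def
  proof (rule integral_cong_AE)
    show "AE u in arcsine_law a. (\<Sum>n. ?f n u) = (1 - z * of_real u) powr (- of_real a)"
      using AE_arcsine_law
    proof eventually_elim
      case (elim u)
      have "norm (z * of_real u) \<le> norm z * 1"
        unfolding norm_mult using elim by (intro mult_left_mono) auto
      with z have "norm (z * of_real u) < 1" by simp
      from powr_minus_binomial_complex[OF this, of "of_real a"]
      show ?case by (simp add: sums_iff pochhammer_of_real)
    qed
  qed simp_all
  also have "(\<lambda>n. \<integral>u. ?f n u \<partial>arcsine_law a) =
      (\<lambda>n. of_real (pochhammer a n * pochhammer (1 - a) n / (fact n)\<^sup>2) * z ^ n)"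
  proof
    fix n
    have "(\<integral>u. ?f n u \<partial>arcsine_law a) =
        (\<integral>u. (of_real (pochhammer a n / fact n) * z ^ n) * of_real (u ^ n) \<partial>arcsine_law a)"
      by (simp add: power_mult_distrib mult_ac)
    also have "\<dots> = (of_real (pochhammer a n / fact n) * z ^ n) * of_real (\<integral>u. u ^ n \<partial>arcsine_law a)"
      by (simp only: integral_mult_right_zero integral_complex_of_real)
    finally show "(\<integral>u. ?f n u \<partial>arcsine_law a) =
        of_real (pochhammer a n * pochhammer (1 - a) n / (fact n)\<^sup>2) * z ^ n"
      by (simp add: mom power2_eq_square)
  qed
  finally show ?thesis .
qed

lemma euler_integral_has_fps_expansion:
  assumes a: "0 < a" "a < 1"
  shows "euler_integral a has_fps_expansion fps_hypergeo [of_real a, of_real (1 - a)] [1] 1"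
proof -
  let ?F = "fps_hypergeo [complex_of_real a, of_real (1 - a)] [1] 1"
  have nth: "fps_nth ?F n = of_real (pochhammer a n * pochhammer (1 - a) n / (fact n)\<^sup>2)" for n
    by (simp add: pochhammer_of_real pochhammer_fact[symmetric] power2_eq_square del: of_real_diff)
  have sums: "(\<lambda>n. fps_nth ?F n * z ^ n) sums euler_integral a z" if "norm z < 1" for z
    using euler_integral_sums[OF a that] unfolding nth .
  have "conv_radius (fps_nth ?F) \<ge> norm (1 / 2 :: complex)"
    by (rule conv_radius_geI) (use sums[of "1/2"] in \<open>auto simp: sums_iff\<close>)
  then have "fps_conv_radius ?F > 0"
    unfolding fps_conv_radius_def by (rule less_le_trans[rotated]) (simp add: zero_ereal_def)
  moreover have "eventually (\<lambda>z. eval_fps ?F z = euler_integral a z) (nhds 0)"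
    unfolding eventually_nhds_metric
    by (intro exI[of _ 1]) (use sums in \<open>auto simp: eval_fps_def sums_iff simp del: fps_hypergeo_nth\<close>)
  ultimately show ?thesis unfolding has_fps_expansion_def by simp
qed

section \<open>Identification of the chosen branch\<close>

lemma connected_slit_plane: "connected (- (complex_of_real ` {1..}))"
proof (intro starlike_imp_connected, unfold starlike_def, intro bexI ballI subsetI)
  show "0 \<in> - (complex_of_real ` {1..})" by auto
  fix z w assume z: "z \<in> - (complex_of_real ` {1..})" and w: "w \<in> closed_segment 0 z"
  then obtain u where u: "0 \<le> u" "u \<le> 1" "w = z * of_real u"
    by (auto simp: closed_segment_def scaleR_conv_of_real mult_ac)
  have "1 - z * of_real u \<notin> \<real>\<^sub>\<le>\<^sub>0" using z u by (intro one_minus_notin_nonpos_Reals) auto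
  then show "w \<in> - (complex_of_real ` {1..})"
    unfolding u(3) by (metis ComplI diff_le_0_iff_le image_iff atLeast_iff nonpos_Reals_of_real_iff
        of_real_1 of_real_diff)
qed

text \<open>Euler's integral witnesses the existence behind the \<open>SOME\<close> in
  \<open>hyp2F1\<close>. Whatever function was chosen has the same germ at 0, so the identity
  theorem on the connected slit plane forces agreement there.\<close>

lemma hyp2F1_eq_euler_integral:
  assumes a: "0 < a" "a < 1"
  shows "hyp2F1 (of_real a) (of_real (1 - a)) 1 analytic_on - (complex_of_real ` {1..})"
    and "z \<notin> complex_of_real ` {1..} \<Longrightarrow>
           hyp2F1 (of_real a) (of_real (1 - a)) 1 z = euler_integral a z"
proof -
  let ?D = "- (complex_of_real ` {1..})"
  let ?P = "\<lambda>f. f analytic_on ?D \<and> f has_fps_expansion fps_hypergeo [of_real a, of_real (1 - a)] [1] 1"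
  let ?H = "hyp2F1 (of_real a) (of_real (1 - a)) 1"
  have "?P (euler_integral a)"
    using euler_integral_holomorphic[OF a] euler_integral_has_fps_expansion[OF a] open_slit_plane
    by (simp add: analytic_on_open)
  then have H: "?P ?H"
    unfolding hyp2F1_def by (rule someI[of ?P])
  then show "?H analytic_on ?D" by blast
  show "?H z = euler_integral a z" if "z \<notin> complex_of_real ` {1..}"
  proof -
    have "eventually (\<lambda>w. ?H w = euler_integral a w) (nhds 0)"
      using H euler_integral_has_fps_expansion[OF a] unfolding has_fps_expansion_def
      by (auto elim: eventually_elim2)
    then obtain e where e: "e > 0" "\<And>w. dist w 0 < e \<Longrightarrow> ?H w = euler_integral a w"
      by (auto simp: eventually_nhds_metric)
    show ?thesis
    \<comment> \<open>Radius \<open>e\<close> ensures that the germs agree, radius 1 keeps the ball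
      away from the cut.\<close>
    proof (rule analytic_continuation_open[where s="ball 0 (min e 1)" and s'="?D"
            and f="?H" and g="euler_integral a"])
      show "ball 0 (min e 1) \<subseteq> ?D" by auto
      show "?H holomorphic_on ?D" using H by (simp add: analytic_imp_holomorphic)
    qed (use e that open_slit_plane connected_slit_plane euler_integral_holomorphic[OF a] in auto)
  qed
qed

section \<open>Moments on the half-line\<close>

text \<open>The values of \<open>\<^sub>2F\<^sub>1(a, 1 - a; 1; - t)\<close> for
  \<open>t \<ge> 0\<close> as a nonnegative real function, so that the moment computation can use
  integrals in \<open>ennreal\<close>, where sums and integrals commute freely.\<close>

definition euler_fun :: "real \<Rightarrow> real \<Rightarrow> real" where
  "euler_fun a t = (\<integral>u. (1 + t * u) powr (- a) \<partial>arcsine_law a)"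

lemma borel_measurable_euler_fun [measurable]:
  assumes a: "0 < a" "a < 1"
  shows "euler_fun a \<in> borel_measurable borel"
proof -
  interpret finite_measure "arcsine_law a" by (rule finite_measure_arcsine_law[OF a])
  show ?thesis unfolding euler_fun_def[abs_def] by measurable
qed

lemma powr_minus_le_1: "(1 + x) powr (- a) \<le> 1" if "x \<ge> 0" "a \<ge> 0" for x a :: real
  using that powr_mono[of "- a" 0 "1 + x"] by simp

lemma integrable_euler_fun:
  assumes a: "0 < a" "a < 1" and t: "t \<ge> 0"
  shows "integrable (arcsine_law a) (\<lambda>u. (1 + t * u) powr (- a))"
  by (rule integrable_arcsine_law[OF a, where B=1]) (use t a in \<open>auto intro!: powr_minus_le_1\<close>)

lemma euler_fun_nonneg: "0 \<le> euler_fun a t"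
  unfolding euler_fun_def by (rule Bochner_Integration.integral_nonneg) simp

lemma euler_fun_le_1:
  assumes a: "0 < a" "a < 1" and t: "t \<ge> 0"
  shows "euler_fun a t \<le> 1"
proof -
  have "euler_fun a t \<le> (\<integral>u. 1 \<partial>arcsine_law a)"
    unfolding euler_fun_def
  proof (rule integral_mono_AE)
    show "AE u in arcsine_law a. (1 + t * u) powr (- a) \<le> 1"
      using AE_arcsine_law by eventually_elim (use a t in \<open>auto intro!: powr_minus_le_1\<close>)
    show "integrable (arcsine_law a) (\<lambda>u. 1 :: real)"
      by (rule integrable_arcsine_law[OF a]) auto
  qed (rule integrable_euler_fun[OF assms])
  also have "\<dots> = 1" using emeasure_arcsine_law[OF a] by (simp add: measure_def)
  finally show ?thesis .
qed

lemma euler_integral_neg_real: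
  assumes a: "0 < a" "a < 1" and t: "t \<ge> 0"
  shows "euler_integral a (- of_real t) = of_real (euler_fun a t)"
proof -
  have "euler_integral a (- of_real t) = (\<integral>u. complex_of_real ((1 + t * u) powr (- a)) \<partial>arcsine_law a)"
    unfolding euler_integral_def
  proof (rule integral_cong_AE)
    show "AE u in arcsine_law a. (1 - - complex_of_real t * complex_of_real u) powr - complex_of_real a =
             complex_of_real ((1 + t * u) powr - a)"
      using AE_arcsine_law
    proof eventually_elim
      case (elim u)
      then show ?case using t powr_of_real[of "1 + t * u" "- a"] by simp
    qed
  qed simp_all
  then show ?thesis by (simp only: euler_fun_def integral_complex_of_real)
qed

text \<open>This is the Beta function \<open>B(k + 1, s)\<close> in its form on the half-line. The
  induction on \<open>k\<close> lets \<open>s\<close> vary: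
  \<open>t / (1 + t) = 1 - 1 / (1 + t)\<close> leads from \<open>s\<close> to the difference with
  \<open>s + 1\<close>.\<close>

lemma has_bochner_integral_beta_second_kind:
  fixes s :: real
  assumes "s > 0"
  shows "has_bochner_integral lborel (\<lambda>t. indicator {0..} t * ((1 + t) powr (- s - 1) * (t / (1 + t)) ^ k))
           (fact k / pochhammer s (Suc k))"
  using assms
proof (induction k arbitrary: s)
  case 0
  have "((\<lambda>t::real. - ((1 + t) powr (- s)) / s) \<longlongrightarrow> - 0 / s) at_top"
    using 0 by (intro tendsto_intros tendsto_neg_powr filterlim_tendsto_add_at_top[OF tendsto_const]
        filterlim_ident) auto
  then have "(\<integral>\<^sup>+t. ennreal ((1 + t) powr (- s - 1)) * indicator {0..} t \<partial>lborel) =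
      ennreal (- 0 / s - (- ((1 + 0) powr (- s)) / s))"
    using 0 by (intro nn_integral_FTC_atLeast) (auto intro!: derivative_eq_intros)
  moreover have "ennreal ((1 + t) powr (- s - 1)) * indicator {0..} t =
      ennreal (indicator {0..} t * ((1 + t) powr (- s - 1) * (t / (1 + t)) ^ 0))" for t
    by (simp split: split_indicator)
  ultimately show ?case
    using 0 by (intro has_bochner_integral_nn_integral) auto
next
  case (Suc k)
  have "has_bochner_integral lborel
      (\<lambda>t. indicator {0..} t * ((1 + t) powr (- s - 1) * (t / (1 + t)) ^ k) -
           indicator {0..} t * ((1 + t) powr (- (s + 1) - 1) * (t / (1 + t)) ^ k))
      (fact k / pochhammer s (Suc k) - fact k / pochhammer (s + 1) (Suc k))"
    using Suc.prems by (intro has_bochner_integral_diff Suc.IH) auto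
  also have "fact k / pochhammer s (Suc k) - fact k / pochhammer (s + 1) (Suc k) =
      fact (Suc k) / pochhammer s (Suc (Suc k))"
  proof (rule pochhammer_reciprocal_diff)
    show "s + real j \<noteq> 0" for j using Suc.prems by linarith
  qed
  also have "(\<lambda>t. indicator {0..} t * ((1 + t) powr (- s - 1) * (t / (1 + t)) ^ k) -
           indicator {0..} t * ((1 + t) powr (- (s + 1) - 1) * (t / (1 + t)) ^ k)) =
      (\<lambda>t. indicator {0..} t * ((1 + t) powr (- s - 1) * (t / (1 + t)) ^ Suc k))"
  proof
    fix t :: real
    show "indicator {0..} t * ((1 + t) powr (- s - 1) * (t / (1 + t)) ^ k) -
           indicator {0..} t * ((1 + t) powr (- (s + 1) - 1) * (t / (1 + t)) ^ k) =
         indicator {0..} t * ((1 + t) powr (- s - 1) * (t / (1 + t)) ^ Suc k)"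
    proof (cases "t \<ge> 0")
      case True
      then have "(1 + t) powr (- (s + 1) - 1) = (1 + t) powr (- s - 1) * (1 - t / (1 + t))"
        using powr_add[of "1 + t" "- s - 1" "-1"] by (simp add: powr_minus field_simps)
      moreover have "i * (p * y) - i * (p * (1 - x) * y) = i * (p * (x * y))" for i p x y :: real
        by (simp add: algebra_simps)
      ultimately show ?thesis by (simp only: power_Suc)
    qed simp
  qed
  finally show ?case .
qed

text \<open>Gauss' evaluation of \<open>\<^sub>2F\<^sub>1(a, a; a + n + 1; 1)\<close>, obtained by integrating the binomial series
  against a Beta density.\<close>

lemma suminf_Gauss:
  assumes a: "0 < a" "a < 1"
  shows "(\<Sum>k. ennreal ((pochhammer a k / fact k)\<^sup>2 * (fact k / pochhammer (a + real n) (Suc k)))) =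
           ennreal (Gamma (a + real n) * Gamma (1 - a + real n) / (fact n)\<^sup>2)"
proof -
  have pos: "pochhammer a k > 0" for k using a by (intro pochhammer_pos) auto
  have G: "Gamma (a + real n) > 0" "Gamma a > 0" "Gamma (1 - a + real n) > 0"
    using a by (auto intro!: Gamma_real_pos)
  \<comment> \<open>With this constant one of the two factors \<open>pochhammer a k\<close> is
    absorbed into \<open>Beta (a + k) (1 + n)\<close>; the other is left as the coefficient of the
    binomial series of \<open>(1 - x) powr (- a)\<close>.\<close>
  define C where "C = Gamma (a + real n) / (Gamma a * fact n)"
  have C: "C > 0" using G by (simp add: C_def)
  have B: "Beta (a + real k) (1 + real n) > 0" for k using a by (intro Beta_real_pos) auto
  have coeff: "(pochhammer a k / fact k)\<^sup>2 * (fact k / pochhammer (a + real n) (Suc k)) =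
      C * (pochhammer a k / fact k * Beta (a + real k) (1 + real n))" for k
  proof -
    have 1: "Gamma (a + real k) = pochhammer a k * Gamma a" using a by (intro Gamma_add_nat) auto
    have 2: "Gamma (a + real n + real (Suc k)) = pochhammer (a + real n) (Suc k) * Gamma (a + real n)"
      using a by (intro Gamma_add_nat) auto
    have 3: "Gamma (1 + real n) = fact n" by (simp add: Gamma_fact)
    have 4: "a + real k + (1 + real n) = a + real n + real (Suc k)" by simp
    have "pochhammer (a + real n) (Suc k) > 0" using a by (intro pochhammer_pos) auto
    then show ?thesis
      unfolding Beta_def C_def 1 3 4 2 using G by (simp add: power2_eq_square)
  qed
  have "(\<Sum>k. ennreal (pochhammer a k / fact k * Beta (a + real k) (1 + real n))) =
      (\<Sum>k. \<integral>\<^sup>+x. ennreal (pochhammer a k / fact k) *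
         ennreal (indicator {0..1} x * (x powr (a + real k - 1) * (1 - x) powr (1 + real n - 1))) \<partial>lborel)"
  proof (rule suminf_cong)
    fix k
    show "ennreal (pochhammer a k / fact k * Beta (a + real k) (1 + real n)) =
      (\<integral>\<^sup>+x. ennreal (pochhammer a k / fact k) *
         ennreal (indicator {0..1} x * (x powr (a + real k - 1) * (1 - x) powr (1 + real n - 1))) \<partial>lborel)"
      using a pos[of k] B[of k] by (subst nn_integral_cmult, measurable, subst nn_integral_Beta)
        (auto intro!: ennreal_mult less_imp_le simp del: times_divide_eq_left)
  qed
  also have "\<dots> = (\<integral>\<^sup>+x. (\<Sum>k. ennreal (pochhammer a k / fact k) *
         ennreal (indicator {0..1} x * (x powr (a + real k - 1) * (1 - x) powr (1 + real n - 1)))) \<partial>lborel)"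
    by (rule nn_integral_suminf[symmetric]) measurable
  also have "\<dots> = (\<integral>\<^sup>+x. ennreal (indicator {0..1} x * (x powr (a - 1) * (1 - x) powr ((1 - a + real n) - 1))) \<partial>lborel)"
  proof (rule nn_integral_cong_AE)
    \<comment> \<open>The binomial series is summed only for \<open>x < 1\<close>; the endpoint is a
      null set. At 0 both integrands vanish by \<open>0 powr _ = 0\<close>.\<close>
    have "AE x in lborel. x \<noteq> (1::real)" by (rule AE_lborel_singleton)
    then show "AE x in lborel. (\<Sum>k. ennreal (pochhammer a k / fact k) *
         ennreal (indicator {0..1} x * (x powr (a + real k - 1) * (1 - x) powr (1 + real n - 1)))) =
         ennreal (indicator {0..1} x * (x powr (a - 1) * (1 - x) powr ((1 - a + real n) - 1)))"
    proof eventually_elim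
      case (elim x)
      show ?case
      proof (cases "0 < x \<and> x < 1")
        case True
        have "(\<lambda>k. x powr (a - 1) * (1 - x) powr (real n) * (pochhammer a k / fact k * x ^ k)) sums
            (x powr (a - 1) * (1 - x) powr (real n) * (1 - x) powr (- a))"
          using True by (intro sums_mult powr_minus_binomial_real) auto
        moreover have "x powr (a - 1) * (1 - x) powr (real n) * (1 - x) powr (- a) =
            x powr (a - 1) * (1 - x) powr ((1 - a + real n) - 1)"
          by (simp add: mult.assoc powr_add[symmetric])
        moreover have "x powr (a - 1) * (1 - x) powr (real n) * (pochhammer a k / fact k * x ^ k) =
            pochhammer a k / fact k * (x powr (a + real k - 1) * (1 - x) powr (1 + real n - 1))" for k
        proof -
          have "x powr (a + real k - 1) = x powr (a - 1) * x ^ k"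
            using True powr_add[of x "a - 1" "real k"] by (simp add: powr_realpow add_diff_eq add.commute)
          then show ?thesis by simp
        qed
        ultimately have "(\<lambda>k. pochhammer a k / fact k * (x powr (a + real k - 1) * (1 - x) powr (1 + real n - 1)))
             sums (x powr (a - 1) * (1 - x) powr ((1 - a + real n) - 1))"
          by (simp only:)
        then have "(\<Sum>k. ennreal (pochhammer a k / fact k * (x powr (a + real k - 1) * (1 - x) powr (1 + real n - 1))))
             = ennreal (x powr (a - 1) * (1 - x) powr ((1 - a + real n) - 1))"
          using pos by (intro suminf_ennreal_eq) (auto simp: less_imp_le)
        moreover have "ennreal (pochhammer a k / fact k) *
             ennreal (indicator {0..1} x * (x powr (a + real k - 1) * (1 - x) powr (1 + real n - 1))) =
            ennreal (pochhammer a k / fact k * (x powr (a + real k - 1) * (1 - x) powr (1 + real n - 1)))" for k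
          using True pos[of k] by (subst ennreal_mult) auto
        ultimately show ?thesis using True by simp
      next
        case False
        with elim have "x = 0 \<or> x \<notin> {0..1}" by auto
        then show ?thesis by auto
      qed
    qed
  qed
  also have "\<dots> = ennreal (Beta a (1 - a + real n))"
    using a by (intro nn_integral_Beta) auto
  finally have sum: "(\<Sum>k. ennreal (pochhammer a k / fact k * Beta (a + real k) (1 + real n))) =
      ennreal (Beta a (1 - a + real n))" .
  have "(\<Sum>k. ennreal ((pochhammer a k / fact k)\<^sup>2 * (fact k / pochhammer (a + real n) (Suc k)))) =
      ennreal C * (\<Sum>k. ennreal (pochhammer a k / fact k * Beta (a + real k) (1 + real n)))"
    unfolding coeff ennreal_suminf_cmult[symmetric] using C pos B
    by (intro suminf_cong ennreal_mult) (auto intro!: mult_nonneg_nonneg less_imp_le)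
  also have "\<dots> = ennreal (C * Beta a (1 - a + real n))"
    unfolding sum using C a Beta_real_pos[of a "1 - a + real n"]
    by (intro ennreal_mult[symmetric]) auto
  also have "C * Beta a (1 - a + real n) = Gamma (a + real n) * Gamma (1 - a + real n) / (fact n)\<^sup>2"
  proof -
    have "Gamma (a + (1 - a + real n)) = fact n" by (simp add: Gamma_fact)
    then show ?thesis using G unfolding Beta_def C_def by (simp only:) (simp add: power2_eq_square)
  qed
  finally show ?thesis .
qed

text \<open>Pfaff's transformation, read off from
  \<open>1 + t u = (1 + t) (1 - (1 - u) t / (1 + t))\<close> and the binomial series in
  \<open>(1 - u) t / (1 + t)\<close>. Unlike the Taylor series in \<open>t\<close>, this converges
  on the whole half-line, and its terms are nonnegative.\<close>

lemma euler_fun_Pfaff: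
  assumes a: "0 < a" "a < 1" and t: "t \<ge> 0"
  shows "ennreal (euler_fun a t) =
    (\<Sum>k. ennreal ((pochhammer a k / fact k)\<^sup>2 * ((1 + t) powr (- a) * (t / (1 + t)) ^ k)))"
proof -
  have pos: "pochhammer a k > 0" for k using a by (intro pochhammer_pos) auto
  have x: "0 \<le> t / (1 + t)" "t / (1 + t) < 1" using t by auto
  have "ennreal (euler_fun a t) = (\<integral>\<^sup>+u. ennreal ((1 + t * u) powr (- a)) \<partial>arcsine_law a)"
    unfolding euler_fun_def using integrable_euler_fun[OF assms] by (subst nn_integral_eq_integral) auto
  also have "\<dots> = (\<integral>\<^sup>+u. (\<Sum>k. ennreal (pochhammer a k / fact k * ((1 + t) powr (- a) * (t / (1 + t)) ^ k)) *
       ennreal ((1 - u) ^ k)) \<partial>arcsine_law a)"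
  proof (rule nn_integral_cong_AE)
    show "AE u in arcsine_law a. ennreal ((1 + t * u) powr (- a)) =
        (\<Sum>k. ennreal (pochhammer a k / fact k * ((1 + t) powr (- a) * (t / (1 + t)) ^ k)) * ennreal ((1 - u) ^ k))"
      using AE_arcsine_law
    proof eventually_elim
      case (elim u)
      have "(1 - u) * (t / (1 + t)) \<le> 1 * (t / (1 + t))" using elim x by (intro mult_right_mono) auto
      moreover have "0 \<le> (1 - u) * (t / (1 + t))" using elim x by (intro mult_nonneg_nonneg) auto
      ultimately have lt1: "\<bar>(1 - u) * (t / (1 + t))\<bar> < 1" using x by linarith
      moreover have "(\<lambda>k. pochhammer a k / fact k * (c * x ^ k) * (1 - u) ^ k) sums
          (c * (1 - (1 - u) * x) powr (- a))" if "\<bar>(1 - u) * x\<bar> < 1" for c x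
        using sums_mult[OF powr_minus_binomial_real[OF that, of a], of c]
        by (simp add: power_mult_distrib mult_ac)
      ultimately have "(\<lambda>k. pochhammer a k / fact k * ((1 + t) powr (- a) * (t / (1 + t)) ^ k) * (1 - u) ^ k) sums
          ((1 + t) powr (- a) * (1 - (1 - u) * (t / (1 + t))) powr (- a))"
        by blast
      also have "(1 + t) powr (- a) * (1 - (1 - u) * (t / (1 + t))) powr (- a) =
          ((1 + t) * (1 - (1 - u) * (t / (1 + t)))) powr (- a)"
        using t lt1 by (subst powr_mult) auto
      also have "(1 + t) * (1 - (1 - u) * (t / (1 + t))) = 1 + t * u"
        using t by (simp add: field_simps)
      finally have sums: "(\<lambda>k. pochhammer a k / fact k * ((1 + t) powr (- a) * (t / (1 + t)) ^ k) * (1 - u) ^ k) sums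
          (1 + t * u) powr (- a)" .
      have nn: "0 \<le> pochhammer a k / fact k * ((1 + t) powr (- a) * (t / (1 + t)) ^ k)" for k
        using pos[of k] t by simp
      then have "(\<Sum>k. ennreal (pochhammer a k / fact k * ((1 + t) powr (- a) * (t / (1 + t)) ^ k)) * ennreal ((1 - u) ^ k)) =
          (\<Sum>k. ennreal (pochhammer a k / fact k * ((1 + t) powr (- a) * (t / (1 + t)) ^ k) * (1 - u) ^ k))"
        using elim by (intro suminf_cong ennreal_mult[symmetric]) auto
      also have "\<dots> = ennreal ((1 + t * u) powr (- a))"
        using elim by (intro suminf_ennreal_eq sums mult_nonneg_nonneg[OF nn]) auto
      finally show ?case ..
    qed
  qed
  also have "\<dots> = (\<Sum>k. ennreal (pochhammer a k / fact k * ((1 + t) powr (- a) * (t / (1 + t)) ^ k)) *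
       (\<integral>\<^sup>+u. ennreal ((1 - u) ^ k) \<partial>arcsine_law a))"
    by (subst nn_integral_suminf) (measurable, simp add: nn_integral_cmult)
  also have "\<dots> = (\<Sum>k. ennreal ((pochhammer a k / fact k)\<^sup>2 * ((1 + t) powr (- a) * (t / (1 + t)) ^ k)))"
    unfolding arcsine_law_moments(2)[OF a] using pos t
    by (intro suminf_cong) (simp add: power2_eq_square less_imp_le mult_ac flip: ennreal_mult)
  finally show ?thesis .
qed

text \<open>Nonnegativity of the Pfaff series allows termwise integration. Each term is a Beta
  integral of the second kind with \<open>s = a + n\<close>, and the resulting series is the one
  summed by Gauss' theorem.\<close>

lemma nn_integral_euler_fun_moment:
  assumes a: "0 < a" "a < 1"
  shows "(\<integral>\<^sup>+t. ennreal (indicator {0..} t * (euler_fun a t / (1 + t) ^ Suc n)) \<partial>lborel) =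
           ennreal (Gamma (a + real n) * Gamma (1 - a + real n) / (fact n)\<^sup>2)"
proof -
  let ?c = "\<lambda>k. (pochhammer a k / fact k)\<^sup>2"
  let ?g = "\<lambda>k t. indicator {0..} t * ((1 + t) powr (- (a + real n) - 1) * (t / (1 + t)) ^ k)"
  have "(\<integral>\<^sup>+t. ennreal (indicator {0..} t * (euler_fun a t / (1 + t) ^ Suc n)) \<partial>lborel) =
      (\<integral>\<^sup>+t. (\<Sum>k. ennreal (?c k) * ennreal (?g k t)) \<partial>lborel)"
  proof (rule nn_integral_cong)
    fix t :: real
    show "ennreal (indicator {0..} t * (euler_fun a t / (1 + t) ^ Suc n)) =
       (\<Sum>k. ennreal (?c k) * ennreal (?g k t))"
    proof (cases "t \<ge> 0")
      case True
      have "(1 + t) powr (- (a + real n) - 1) = (1 + t) powr (- a) * (1 + t) powr (- real (Suc n))"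
        unfolding powr_add[symmetric] by (rule arg_cong[where f="\<lambda>y. (1 + t) powr y"]) simp
      also have "(1 + t) powr (- real (Suc n)) = 1 / (1 + t) ^ Suc n"
        using True by (subst powr_minus_divide, subst powr_realpow) auto
      finally have *: "(1 + t) powr (- (a + real n) - 1) = (1 + t) powr (- a) * (1 / (1 + t) ^ Suc n)" .
      have "ennreal (indicator {0..} t * (euler_fun a t / (1 + t) ^ Suc n)) =
          ennreal (1 / (1 + t) ^ Suc n) * ennreal (euler_fun a t)"
        using True euler_fun_nonneg[of a t] by (simp del: power_Suc flip: ennreal_mult)
      also have "\<dots> = (\<Sum>k. ennreal (1 / (1 + t) ^ Suc n) *
            ennreal (?c k * ((1 + t) powr (- a) * (t / (1 + t)) ^ k)))"
        by (simp only: euler_fun_Pfaff[OF a True] ennreal_suminf_cmult)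
      also have "\<dots> = (\<Sum>k. ennreal (?c k) * ennreal (?g k t))"
        unfolding * using True
        by (intro suminf_cong) (simp add: mult_ac del: power_Suc flip: ennreal_mult)
      finally show ?thesis .
    qed simp
  qed
  also have "\<dots> = (\<Sum>k. ennreal (?c k) * (\<integral>\<^sup>+t. ennreal (?g k t) \<partial>lborel))"
    by (subst nn_integral_suminf) (measurable, simp add: nn_integral_cmult)
  also have "\<dots> = (\<Sum>k. ennreal (?c k * (fact k / pochhammer (a + real n) (Suc k))))"
  proof (rule suminf_cong)
    fix k
    have *: "pochhammer (a + real n) (Suc k) > 0" using a by (intro pochhammer_pos) auto
    have "has_bochner_integral lborel (?g k) (fact k / pochhammer (a + real n) (Suc k))"
      using a by (intro has_bochner_integral_beta_second_kind) auto
    then have int: "(\<integral>\<^sup>+t. ennreal (?g k t) \<partial>lborel) = ennreal (fact k / pochhammer (a + real n) (Suc k))"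
      by (subst nn_integral_eq_integral)
         (auto simp: has_bochner_integral_iff intro!: AE_I2 split: split_indicator)
    show "ennreal (?c k) * (\<integral>\<^sup>+t. ennreal (?g k t) \<partial>lborel) =
        ennreal (?c k * (fact k / pochhammer (a + real n) (Suc k)))"
      unfolding int using * by (intro ennreal_mult[symmetric]) auto
  qed
  also have "\<dots> = ennreal (Gamma (a + real n) * Gamma (1 - a + real n) / (fact n)\<^sup>2)"
    by (rule suminf_Gauss[OF a])
  finally show ?thesis .
qed

section \<open>Factorial series of Laplace integrals\<close>

lemma has_bochner_integral_exp_minus:
  fixes r :: real
  assumes "r > 0"
  shows "has_bochner_integral lborel (\<lambda>p. indicator {0..} p * exp (- p * r)) (1 / r)"
proof -
  have "filterlim (\<lambda>p. - p * r) at_bot at_top"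
    using filterlim_tendsto_neg_mult_at_bot[OF tendsto_const, of "- r" "\<lambda>p. p" at_top] assms
    by (simp add: mult.commute filterlim_ident)
  then have "((\<lambda>p. exp (- p * r)) \<longlongrightarrow> 0) at_top"
    by (rule filterlim_compose[OF exp_at_bot])
  then have "((\<lambda>p. - exp (- p * r) / r) \<longlongrightarrow> - 0 / r) at_top"
    using assms by (intro tendsto_intros) auto
  then have "(\<integral>\<^sup>+p. ennreal (exp (- p * r)) * indicator {0..} p \<partial>lborel) =
      ennreal (- 0 / r - (- exp (- 0 * r) / r))"
    using assms by (intro nn_integral_FTC_atLeast) (auto intro!: derivative_eq_intros)
  moreover have "ennreal (exp (- p * r)) * indicator {0..} p =
      ennreal (indicator {0..} p * exp (- p * r))" for p
    by (simp split: split_indicator)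
  ultimately show ?thesis
    using assms by (intro has_bochner_integral_nn_integral) auto
qed

lemma norm_laplace_kernel:
  "norm (indicator {0..} p *\<^sub>R exp (- of_real p * x)) = indicator {0..} p * exp (- p * Re x)"
  by (simp split: split_indicator)

lemma integrable_laplace_kernel:
  assumes "Re x > 0"
  shows "integrable lborel (\<lambda>p. indicator {0..} p *\<^sub>R exp (- complex_of_real p * x))"
proof (rule Bochner_Integration.integrable_bound)
  show "integrable lborel (\<lambda>p. indicator {0..} p * exp (- p * Re x))"
    using has_bochner_integral_exp_minus[OF assms] by (simp add: has_bochner_integral_iff)
qed (auto simp: norm_laplace_kernel)

lemma has_bochner_integral_laplace_kernel:
  assumes "Re x > 0"
  shows "has_bochner_integral lborel (\<lambda>p. indicator {0..} p *\<^sub>R exp (- complex_of_real p * x)) (1 / x)"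
proof -
  have x: "x \<noteq> 0" using assms by auto
  have "(\<lambda>n. \<integral>p. indicator {0..real n} p *\<^sub>R exp (- complex_of_real p * x) \<partial>lborel) \<longlonglongrightarrow>
      (\<integral>p. indicator {0..} p *\<^sub>R exp (- complex_of_real p * x) \<partial>lborel)"
  proof (rule integral_dominated_convergence[where w="\<lambda>p. indicator {0..} p * exp (- p * Re x)"])
    show "integrable lborel (\<lambda>p. indicator {0..} p * exp (- p * Re x))"
      using has_bochner_integral_exp_minus[OF assms] by (simp add: has_bochner_integral_iff)
    show "AE p in lborel. (\<lambda>n. indicator {0..real n} p *\<^sub>R exp (- complex_of_real p * x)) \<longlonglongrightarrow>
        indicator {0..} p *\<^sub>R exp (- complex_of_real p * x)"
    proof (rule AE_I2)
      fix p :: real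
      have "eventually (\<lambda>n. p \<le> real n) sequentially"
        using filterlim_real_sequentially by (auto simp: filterlim_at_top)
      then have "eventually (\<lambda>n. indicator {0..real n} p *\<^sub>R exp (- complex_of_real p * x) =
          indicator {0..} p *\<^sub>R exp (- complex_of_real p * x)) sequentially"
        by eventually_elim (simp split: split_indicator)
      then show "(\<lambda>n. indicator {0..real n} p *\<^sub>R exp (- complex_of_real p * x)) \<longlonglongrightarrow>
          indicator {0..} p *\<^sub>R exp (- complex_of_real p * x)"
        by (rule tendsto_eventually)
    qed
  qed (auto simp: split: split_indicator)
  moreover have "(\<integral>p. indicator {0..real n} p *\<^sub>R exp (- complex_of_real p * x) \<partial>lborel) =
      - exp (- of_real (real n) * x) / x - (- exp (- of_real 0 * x) / x)" for n
  proof (rule integral_FTC_atLeastAtMost)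
    show "((\<lambda>p. - exp (- of_real p * x) / x) has_vector_derivative exp (- complex_of_real p * x))
        (at p within {0..real n})" for p
    proof -
      have "((\<lambda>z. - exp (- z * x) / x) has_field_derivative exp (- complex_of_real p * x))
          (at (of_real p))"
        using x by (auto intro!: derivative_eq_intros)
      then show ?thesis
        by (intro has_vector_derivative_real_field)
    qed
  qed (auto intro!: continuous_intros)
  moreover have "(\<lambda>n. - exp (- of_real (real n) * x) / x - (- exp (- of_real 0 * x) / x)) \<longlonglongrightarrow> - 0 / x - (- 1 / x)"
  proof -
    have "(\<lambda>n. exp (- real n * Re x)) \<longlonglongrightarrow> 0"
    proof (rule filterlim_compose[OF exp_at_bot])
      show "filterlim (\<lambda>n. - real n * Re x) at_bot sequentially"
        using filterlim_tendsto_neg_mult_at_bot[OF tendsto_const _ filterlim_real_sequentially, of "- Re x"]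
          assms by (simp add: mult.commute)
    qed
    then have "(\<lambda>n. norm (exp (- complex_of_real (real n) * x))) \<longlonglongrightarrow> 0"
      by simp
    then have "(\<lambda>n. exp (- complex_of_real (real n) * x)) \<longlonglongrightarrow> 0"
      by (rule tendsto_norm_zero_cancel)
    then show ?thesis using x by (intro tendsto_intros) auto
  qed
  ultimately have "(\<integral>p. indicator {0..} p *\<^sub>R exp (- complex_of_real p * x) \<partial>lborel) = 1 / x"
    using LIMSEQ_unique by fastforce
  then show ?thesis
    using integrable_laplace_kernel[OF assms] by (simp add: has_bochner_integral_iff)
qed

text \<open>A factor \<open>1 - exp (- p)\<close> subtracts from the integral at \<open>x\<close>
  the one at \<open>x + 1\<close>, so induction on \<open>j\<close>, with \<open>x\<close>
  arbitrary, reduces to the difference formula for reciprocal Pochhammer symbols.\<close>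

lemma has_bochner_integral_laplace_factorial:
  assumes "Re x > 0"
  shows "has_bochner_integral lborel
    (\<lambda>p. indicator {0..} p *\<^sub>R exp (- complex_of_real p * x) * of_real (1 - exp (- p)) ^ j)
    (fact j / pochhammer x (Suc j))"
  using assms
proof (induction j arbitrary: x)
  case 0
  then show ?case using has_bochner_integral_laplace_kernel[of x] by simp
next
  case (Suc j)
  have "has_bochner_integral lborel
    (\<lambda>p. indicator {0..} p *\<^sub>R exp (- complex_of_real p * x) * of_real (1 - exp (- p)) ^ j -
         indicator {0..} p *\<^sub>R exp (- complex_of_real p * (x + 1)) * of_real (1 - exp (- p)) ^ j)
    (fact j / pochhammer x (Suc j) - fact j / pochhammer (x + 1) (Suc j))"
    using Suc.prems by (intro has_bochner_integral_diff Suc.IH) auto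
  also have "fact j / pochhammer x (Suc j) - fact j / pochhammer (x + 1) (Suc j) =
      fact (Suc j) / pochhammer x (Suc (Suc j))"
  proof (rule pochhammer_reciprocal_diff)
    fix i :: nat
    have "Re (x + of_nat i) > 0" using Suc.prems by simp
    then show "x + of_nat i \<noteq> 0" by force
  qed
  also have "(\<lambda>p. indicator {0..} p *\<^sub>R exp (- complex_of_real p * x) * of_real (1 - exp (- p)) ^ j -
         indicator {0..} p *\<^sub>R exp (- complex_of_real p * (x + 1)) * of_real (1 - exp (- p)) ^ j) =
      (\<lambda>p. indicator {0..} p *\<^sub>R exp (- complex_of_real p * x) * of_real (1 - exp (- p)) ^ Suc j)"
  proof
    fix p :: real
    have e: "exp (- complex_of_real p * (x + 1)) = exp (- complex_of_real p * x) * of_real (exp (- p))"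
      by (simp add: exp_of_real[symmetric] exp_add[symmetric] algebra_simps)
    have "(i *\<^sub>R u) * v - (i *\<^sub>R (u * of_real w)) * v = i *\<^sub>R u * (of_real (1 - w) * v)"
      for i w :: real and u v :: complex
      by (simp add: algebra_simps)
    then show "indicator {0..} p *\<^sub>R exp (- complex_of_real p * x) * of_real (1 - exp (- p)) ^ j -
         indicator {0..} p *\<^sub>R exp (- complex_of_real p * (x + 1)) * of_real (1 - exp (- p)) ^ j =
         indicator {0..} p *\<^sub>R exp (- complex_of_real p * x) * of_real (1 - exp (- p)) ^ Suc j"
      unfolding e power_Suc by blast
  qed
  finally show ?case .
qed

lemma laplace_factorial_kernel_le:
  fixes p r :: real
  shows "indicator {0..} p * exp (- p * r) * \<bar>1 - exp (- p)\<bar> ^ j \<le> indicator {0..} p * exp (- p * r)"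
proof (cases "p \<ge> 0")
  case True
  then have "\<bar>1 - exp (- p)\<bar> ^ j \<le> 1" by (intro power_le_one) auto
  from mult_left_mono[OF this, of "exp (- p * r)"] True show ?thesis
    by simp
qed simp

text \<open>Read off from the Laplace integral, where the powers of \<open>1 - exp (- p)\<close> are
  at most 1. Being uniform in \<open>j\<close>, it lets factorial series inherit geometric
  convergence from their coefficients.\<close>

lemma norm_fact_div_pochhammer_le:
  assumes "Re x > 0"
  shows "norm (fact j / pochhammer x (Suc j)) \<le> 1 / Re x"
proof -
  let ?f = "\<lambda>p. indicator {0..} p *\<^sub>R exp (- complex_of_real p * x) * of_real (1 - exp (- p)) ^ j"
  note f = has_bochner_integral_laplace_factorial[OF assms, of j]
  note g = has_bochner_integral_exp_minus[OF assms]
  have "norm (integral\<^sup>L lborel ?f) \<le> (\<integral>p. indicator {0..} p * exp (- p * Re x) \<partial>lborel)"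
  proof (rule Bochner_Integration.integral_norm_bound_integral)
    fix p :: real
    show "norm (?f p) \<le> indicator {0..} p * exp (- p * Re x)"
      using laplace_factorial_kernel_le[of p "Re x" j]
      by (simp only: norm_mult norm_laplace_kernel norm_power norm_of_real)
  qed (use f g in \<open>auto simp: has_bochner_integral_iff\<close>)
  then show ?thesis using f g by (simp add: has_bochner_integral_iff)
qed

text \<open>Geometric expansion of \<open>1 / (L e\<^sup>q - \<epsilon>)\<close> in powers of \<open>1 - e\<^sup>-\<^sup>q\<close>, with the zeroth term
  and the constant part of the quotient merged into \<open>1 / (L - \<epsilon>)\<close>.\<close>

lemma geometric_expansion:
  fixes L \<epsilon> q :: real
  assumes \<epsilon>: "\<epsilon>\<^sup>2 = 1" and L: "L - \<epsilon> > 1" and q: "q \<ge> 0"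
  shows "(\<lambda>i. (- \<epsilon>) ^ (i + 2) * (L / (L - \<epsilon>) ^ (i + 2)) * (1 - exp (- q)) ^ Suc i) sums
           (1 / (L - \<epsilon>) - 1 / (L * exp q - \<epsilon>))"
proof -
  define v where "v = 1 - exp (- q)"
  have v: "0 \<le> v" "v < 1" using q by (auto simp: v_def)
  have abs\<epsilon>: "\<bar>\<epsilon>\<bar> = 1" using \<epsilon> by (auto simp: power2_eq_1_iff)
  \<comment> \<open>The ratio comes from
    \<open>L exp q - \<epsilon> = exp q (L - \<epsilon>) (1 - y)\<close>.\<close>
  define y where "y = (- \<epsilon>) * (v / (L - \<epsilon>))"
  have "\<bar>y\<bar> = v / (L - \<epsilon>)" using v L abs\<epsilon> by (simp add: y_def abs_mult)
  also have "\<dots> < 1" using v L by simp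
  finally have "(\<lambda>i. y ^ i) sums (1 / (1 - y))" by (intro geometric_sums) simp
  then have "(\<lambda>i. L * v / (L - \<epsilon>)\<^sup>2 * y ^ i) sums (L * v / (L - \<epsilon>)\<^sup>2 * (1 / (1 - y)))"
    by (rule sums_mult)
  also have "(\<lambda>i. L * v / (L - \<epsilon>)\<^sup>2 * y ^ i) = (\<lambda>i. (- \<epsilon>) ^ (i + 2) * (L / (L - \<epsilon>) ^ (i + 2)) * v ^ Suc i)"
  proof
    fix i
    have 1: "(- \<epsilon>) ^ (i + 2) = (- \<epsilon>) ^ i" unfolding power_add power2_minus \<epsilon> by simp
    have 2: "y ^ i = (- \<epsilon>) ^ i * (v ^ i / (L - \<epsilon>) ^ i)"
      unfolding y_def by (simp only: power_mult_distrib power_divide)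
    show "L * v / (L - \<epsilon>)\<^sup>2 * y ^ i = (- \<epsilon>) ^ (i + 2) * (L / (L - \<epsilon>) ^ (i + 2)) * v ^ Suc i"
      unfolding 1 2 using L by (simp add: power_add power2_eq_square mult_ac)
  qed
  also have "L * v / (L - \<epsilon>)\<^sup>2 * (1 / (1 - y)) = 1 / (L - \<epsilon>) - 1 / (L * exp q - \<epsilon>)"
  proof -
    have \<epsilon>1: "\<epsilon> = 1 \<or> \<epsilon> = -1" using \<epsilon> by (simp add: power2_eq_1_iff)
    define E where "E = exp q"
    have E: "E \<ge> 1" "v = 1 - 1 / E" using q by (auto simp: E_def v_def exp_minus field_simps)
    have L0: "L > 0" using L \<epsilon>1 by auto
    have "L * E \<ge> L * 1" using E L0 by (intro mult_left_mono) auto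
    then have nz: "L * E - \<epsilon> \<noteq> 0" "L - \<epsilon> \<noteq> 0" "E \<noteq> 0" using L E by auto
    have y1: "1 - y = (L * E - \<epsilon>) / (E * (L - \<epsilon>))"
      using nz unfolding y_def E(2) by (simp add: field_simps)
    have "L * v / (L - \<epsilon>)\<^sup>2 * (1 / (1 - y)) = L * (E - 1) / ((L - \<epsilon>) * (L * E - \<epsilon>))"
      using nz unfolding y1 E(2) by (simp add: divide_simps power2_eq_square)
    also have "\<dots> = 1 / (L - \<epsilon>) - 1 / (L * E - \<epsilon>)"
      using nz by (simp add: field_simps)
    finally show ?thesis by (simp add: E_def)
  qed
  finally show ?thesis by (simp add: v_def)
qed

text \<open>Termwise Laplace transform of \<open>geometric_expansion\<close>, with \<open>i\<close>
  standing for \<open>m = i + 2\<close>. The assumption \<open>L - \<epsilon> > 1\<close> makes the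
  coefficients geometrically summable, which justifies the exchange.\<close>

lemma laplace_factorial_series:
  fixes x :: complex and L \<epsilon> :: real
  assumes x: "Re x > 0" and \<epsilon>: "\<epsilon>\<^sup>2 = 1" and L: "L - \<epsilon> > 1"
  shows "(\<lambda>i. fact (Suc i) / pochhammer x (i + 2) * of_real ((- \<epsilon>) ^ (i + 2) * (L / (L - \<epsilon>) ^ (i + 2)))) sums
    (of_real (1 / (L - \<epsilon>)) / x -
      (\<integral>p. indicator {0..} p *\<^sub>R exp (- complex_of_real p * x) * of_real (1 / (L * exp p - \<epsilon>)) \<partial>lborel))"
proof -
  let ?k = "\<lambda>p. indicator {0..} p *\<^sub>R exp (- complex_of_real p * x)"
  let ?c = "\<lambda>i. (- \<epsilon>) ^ (i + 2) * (L / (L - \<epsilon>) ^ (i + 2))"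
  let ?f = "\<lambda>i p. of_real (?c i) * (?k p * of_real (1 - exp (- p)) ^ Suc i)"
  have abs\<epsilon>: "\<bar>\<epsilon>\<bar> = 1" using \<epsilon> by (auto simp: power2_eq_1_iff)
  have L0: "L > 0" using L \<epsilon> by (auto simp: power2_eq_1_iff)
  have c: "\<bar>?c i\<bar> = L / (L - \<epsilon>)\<^sup>2 * (1 / (L - \<epsilon>)) ^ i" for i
    using abs\<epsilon> L L0 by (simp add: abs_mult power_abs power_divide power2_eq_square)
  have S: "summable (\<lambda>i. B * \<bar>?c i\<bar>)" for B
    unfolding c using L by (intro summable_mult summable_geometric) auto
  have int: "has_bochner_integral lborel (?f i) (of_real (?c i) * (fact (Suc i) / pochhammer x (i + 2)))" for i
    using has_bochner_integral_laplace_factorial[OF x, of "Suc i"] by (intro has_bochner_integral_mult_right) simp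
  have intf: "integrable lborel (?f i)" for i using int[of i] unfolding has_bochner_integral_iff by blast
  note g = has_bochner_integral_exp_minus[OF x]
  then have intg: "integrable lborel (\<lambda>p. indicator {0..} p * exp (- p * Re x))"
    unfolding has_bochner_integral_iff by blast
  have nf: "norm (?f i p) \<le> \<bar>?c i\<bar> * (indicator {0..} p * exp (- p * Re x))" for i p
    using mult_left_mono[OF laplace_factorial_kernel_le[of p "Re x" "Suc i"], of "\<bar>?c i\<bar>"]
    by (simp only: norm_mult norm_laplace_kernel norm_power norm_of_real abs_ge_zero)
  have "(\<lambda>i. integral\<^sup>L lborel (?f i)) sums (\<integral>p. (\<Sum>i. ?f i p) \<partial>lborel)"
  proof (rule sums_integral)
    show "integrable lborel (?f i)" for i by (rule intf)
    show "AE p in lborel. summable (\<lambda>i. norm (?f i p))"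
    proof (rule AE_I2)
      fix p :: real
      show "summable (\<lambda>i. norm (?f i p))"
        by (rule summable_comparison_test'[OF S[of "indicator {0..} p * exp (- p * Re x)"], of 0])
           (use nf in \<open>simp add: mult.commute\<close>)
    qed
    show "summable (\<lambda>i. \<integral>p. norm (?f i p) \<partial>lborel)"
    proof (rule summable_comparison_test'[OF S[of "1 / Re x"], of 0])
      fix i
      have "(\<integral>p. norm (?f i p) \<partial>lborel) \<le> (\<integral>p. \<bar>?c i\<bar> * (indicator {0..} p * exp (- p * Re x)) \<partial>lborel)"
        by (rule integral_mono[OF integrable_norm[OF intf] integrable_mult_right[OF intg] nf])
      also have "\<dots> = 1 / Re x * \<bar>?c i\<bar>"
        using g by (subst integral_mult_right_zero) (simp add: has_bochner_integral_iff)
      finally show "norm (\<integral>p. norm (?f i p) \<partial>lborel) \<le> 1 / Re x * \<bar>?c i\<bar>"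
        by (subst real_norm_def, subst abs_of_nonneg) (rule Bochner_Integration.integral_nonneg, simp)
    qed
  qed
  also have "(\<lambda>i. integral\<^sup>L lborel (?f i)) = (\<lambda>i. fact (Suc i) / pochhammer x (i + 2) * of_real (?c i))"
    using int by (simp add: has_bochner_integral_iff mult.commute)
  also have "(\<integral>p. (\<Sum>i. ?f i p) \<partial>lborel) =
      (\<integral>p. of_real (1 / (L - \<epsilon>)) * ?k p - ?k p * of_real (1 / (L * exp p - \<epsilon>)) \<partial>lborel)"
  proof (rule Bochner_Integration.integral_cong[OF refl])
    fix p :: real
    show "(\<Sum>i. ?f i p) = of_real (1 / (L - \<epsilon>)) * ?k p - ?k p * of_real (1 / (L * exp p - \<epsilon>))"
    proof (cases "p \<ge> 0")
      case True
      have "(\<lambda>i. ?k p * of_real (?c i * (1 - exp (- p)) ^ Suc i)) sums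
          (?k p * of_real (1 / (L - \<epsilon>) - 1 / (L * exp p - \<epsilon>)))"
        by (intro sums_mult sums_of_real geometric_expansion \<epsilon> L True)
      also have "(\<lambda>i. ?k p * of_real (?c i * (1 - exp (- p)) ^ Suc i)) = (\<lambda>i. ?f i p)"
        by (simp only: of_real_mult of_real_power mult_ac)
      finally show ?thesis by (simp add: sums_iff algebra_simps)
    qed simp
  qed
  also have "\<dots> = (\<integral>p. of_real (1 / (L - \<epsilon>)) * ?k p \<partial>lborel) - (\<integral>p. ?k p * of_real (1 / (L * exp p - \<epsilon>)) \<partial>lborel)"
  proof (rule Bochner_Integration.integral_diff)
    show "integrable lborel (\<lambda>p. of_real (1 / (L - \<epsilon>)) * ?k p)"
      by (intro integrable_mult_right integrable_laplace_kernel x)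
    show "integrable lborel (\<lambda>p. ?k p * of_real (1 / (L * exp p - \<epsilon>)))"
    proof (rule Bochner_Integration.integrable_bound)
      show "integrable lborel ?k" by (rule integrable_laplace_kernel[OF x])
      show "AE p in lborel. norm (?k p * of_real (1 / (L * exp p - \<epsilon>))) \<le> norm (?k p)"
      proof (rule AE_I2)
        fix p :: real
        show "norm (?k p * of_real (1 / (L * exp p - \<epsilon>))) \<le> norm (?k p)"
        proof (cases "p \<ge> 0")
          case True
          then have "L * 1 \<le> L * exp p" using L0 by (intro mult_left_mono) auto
          then have "\<bar>1 / (L * exp p - \<epsilon>)\<bar> \<le> 1" using L by (simp add: abs_if)
          then show ?thesis unfolding norm_mult norm_of_real by (intro mult_left_le) auto
        qed simp
      qed
    qed measurable
  qed
  also have "(\<integral>p. of_real (1 / (L - \<epsilon>)) * ?k p \<partial>lborel) = of_real (1 / (L - \<epsilon>)) / x"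
    using has_bochner_integral_laplace_kernel[OF x] by (subst integral_mult_right_zero) (simp add: has_bochner_integral_iff)
  finally show ?thesis .
qed

text \<open>One class for \<open>1 / y\<close>, all dyadic kernels and the partial sums of the
  decomposition. The range \<open>y \<ge> 1\<close> suffices because kernels are evaluated at
  \<open>1 + t + p\<close>.\<close>

definition laplace_dominated :: "(real \<Rightarrow> real) \<Rightarrow> bool" where
  "laplace_dominated q \<longleftrightarrow> q \<in> borel_measurable borel \<and> (\<forall>y\<ge>1. \<bar>q y\<bar> \<le> 1 / y)"

lemma laplace_dominated_inverse: "laplace_dominated (\<lambda>y. 1 / y)"
  unfolding laplace_dominated_def by (auto simp: abs_if)

text \<open>Equal to \<open>\<integral> exp (- p x) (q (1 + t) - q (1 + t + p)) dp\<close>, the part of the Laplace transform that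
  the factorial series account for; the first summand is their term \<open>m = 1\<close>.\<close>

definition laplace_defect :: "complex \<Rightarrow> (real \<Rightarrow> real) \<Rightarrow> real \<Rightarrow> complex" where
  "laplace_defect x q t = of_real (q (1 + t)) / x -
     (\<integral>p. indicator {0..} p *\<^sub>R exp (- complex_of_real p * x) * of_real (q (1 + t + p)) \<partial>lborel)"

lemma laplace_dominated_kernel_bound:
  assumes q: "laplace_dominated q" and t: "t \<ge> 0"
  shows "norm (indicator {0..} p *\<^sub>R exp (- complex_of_real p * x) * of_real (q (1 + t + p)))
           \<le> 1 / (1 + t) * (indicator {0..} p * exp (- p * Re x))"
proof (cases "p \<ge> 0")
  case True
  have "\<bar>q (1 + t + p)\<bar> \<le> 1 / (1 + t + p)" using q t True by (simp add: laplace_dominated_def)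
  also have "\<dots> \<le> 1 / (1 + t)" using t True by (intro divide_left_mono) auto
  finally have "\<bar>q (1 + t + p)\<bar> \<le> 1 / (1 + t)" .
  from mult_left_mono[OF this, of "indicator {0..} p * exp (- p * Re x)"]
  have "indicator {0..} p * exp (- p * Re x) * \<bar>q (1 + t + p)\<bar> \<le>
      1 / (1 + t) * (indicator {0..} p * exp (- p * Re x))"
    by (simp add: mult.commute)
  then show ?thesis
    by (simp only: norm_mult norm_laplace_kernel norm_of_real)
qed simp

lemma integrable_laplace_dominated:
  assumes x: "Re x > 0" and q: "laplace_dominated q" and t: "t \<ge> 0"
  shows "integrable lborel (\<lambda>p. indicator {0..} p *\<^sub>R exp (- complex_of_real p * x) * of_real (q (1 + t + p)))"
proof (rule Bochner_Integration.integrable_bound)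
  show "integrable lborel (\<lambda>p. 1 / (1 + t) * (indicator {0..} p * exp (- p * Re x)))"
    using has_bochner_integral_exp_minus[OF x] unfolding has_bochner_integral_iff
    by (intro integrable_mult_right) blast
  have [measurable]: "q \<in> borel_measurable borel" using q by (simp add: laplace_dominated_def)
  show "(\<lambda>p. indicator {0..} p *\<^sub>R exp (- complex_of_real p * x) * of_real (q (1 + t + p)))
      \<in> borel_measurable lborel"
    by measurable
  show "AE p in lborel. norm (indicator {0..} p *\<^sub>R exp (- complex_of_real p * x) * of_real (q (1 + t + p)))
      \<le> norm (1 / (1 + t) * (indicator {0..} p * exp (- p * Re x)))"
    using laplace_dominated_kernel_bound[OF q t] t by (intro AE_I2) auto
qed

text \<open>The bound is independent of \<open>q\<close>, hence a single majorant in
  \<open>t\<close> for all kernels and partial sums at once.\<close>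

lemma norm_laplace_defect_le:
  assumes x: "Re x > 0" and q: "laplace_dominated q" and t: "t \<ge> 0"
  shows "norm (laplace_defect x q t) \<le> (1 / norm x + 1 / Re x) * (1 / (1 + t))"
proof -
  let ?f = "\<lambda>p. indicator {0..} p *\<^sub>R exp (- complex_of_real p * x) * of_real (q (1 + t + p))"
  note g = has_bochner_integral_mult_right[OF has_bochner_integral_exp_minus[OF x], of "1 / (1 + t)"]
  have "norm (integral\<^sup>L lborel ?f) \<le>
      (\<integral>p. 1 / (1 + t) * (indicator {0..} p * exp (- p * Re x)) \<partial>lborel)"
    using laplace_dominated_kernel_bound[OF q t] integrable_laplace_dominated[OF x q t] g
    by (intro Bochner_Integration.integral_norm_bound_integral) (auto simp: has_bochner_integral_iff)
  also have "\<dots> = 1 / (1 + t) * (1 / Re x)" using g by (simp only: has_bochner_integral_iff)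
  finally have 1: "norm (integral\<^sup>L lborel ?f) \<le> 1 / Re x * (1 / (1 + t))" by (simp add: mult.commute)
  have "\<bar>q (1 + t)\<bar> \<le> 1 / (1 + t)" using q t by (simp add: laplace_dominated_def)
  then have "norm (of_real (q (1 + t)) / x) \<le> 1 / norm x * (1 / (1 + t))"
    using divide_right_mono[of "\<bar>q (1 + t)\<bar>" "1 / (1 + t)" "norm x"] by (simp add: norm_divide mult.commute)
  with 1 have "norm (of_real (q (1 + t)) / x) + norm (integral\<^sup>L lborel ?f) \<le>
      (1 / norm x + 1 / Re x) * (1 / (1 + t))"
    unfolding distrib_right by (rule add_mono[rotated])
  then show ?thesis
    unfolding laplace_defect_def by (rule order_trans[OF norm_triangle_ineq4])
qed

lemma borel_measurable_laplace_defect: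
  assumes "laplace_dominated q"
  shows "laplace_defect x q \<in> borel_measurable borel"
proof -
  have [measurable]: "q \<in> borel_measurable borel" using assms by (simp add: laplace_dominated_def)
  show ?thesis unfolding laplace_defect_def[abs_def] by measurable
qed

lemma laplace_defect_sum:
  assumes x: "Re x > 0" and q: "\<And>k. laplace_dominated (q k)" and t: "t \<ge> 0"
  shows "laplace_defect x (\<lambda>y. \<Sum>k<n. q k y) t = (\<Sum>k<n. laplace_defect x (q k) t)"
proof -
  have "(\<integral>p. indicator {0..} p *\<^sub>R exp (- complex_of_real p * x) * of_real (\<Sum>k<n. q k (1 + t + p)) \<partial>lborel) =
      (\<Sum>k<n. \<integral>p. indicator {0..} p *\<^sub>R exp (- complex_of_real p * x) * of_real (q k (1 + t + p)) \<partial>lborel)"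
    unfolding of_real_sum sum_distrib_left
    by (rule Bochner_Integration.integral_sum) (rule integrable_laplace_dominated[OF x q t])
  then show ?thesis
    by (simp only: laplace_defect_def of_real_sum sum_divide_distrib sum_subtractf)
qed

lemma laplace_defect_tendsto:
  assumes x: "Re x > 0" and q: "\<And>n. laplace_dominated (q n)" and Q: "laplace_dominated Q"
    and lim: "\<And>y. y \<ge> 1 \<Longrightarrow> (\<lambda>n. q n y) \<longlonglongrightarrow> Q y" and t: "t \<ge> 0"
  shows "(\<lambda>n. laplace_defect x (q n) t) \<longlonglongrightarrow> laplace_defect x Q t"
proof -
  have "(\<lambda>n. \<integral>p. indicator {0..} p *\<^sub>R exp (- complex_of_real p * x) * of_real (q n (1 + t + p)) \<partial>lborel)
     \<longlonglongrightarrow> (\<integral>p. indicator {0..} p *\<^sub>R exp (- complex_of_real p * x) * of_real (Q (1 + t + p)) \<partial>lborel)"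
  proof (rule integral_dominated_convergence)
    show "integrable lborel (\<lambda>p. 1 / (1 + t) * (indicator {0..} p * exp (- p * Re x)))"
      using has_bochner_integral_exp_minus[OF x] unfolding has_bochner_integral_iff
      by (intro integrable_mult_right) blast
    show "AE p in lborel. (\<lambda>n. indicator {0..} p *\<^sub>R exp (- complex_of_real p * x) * of_real (q n (1 + t + p)))
        \<longlonglongrightarrow> indicator {0..} p *\<^sub>R exp (- complex_of_real p * x) * of_real (Q (1 + t + p))"
    proof (rule AE_I2)
      fix p :: real
      show "(\<lambda>n. indicator {0..} p *\<^sub>R exp (- complex_of_real p * x) * of_real (q n (1 + t + p)))
        \<longlonglongrightarrow> indicator {0..} p *\<^sub>R exp (- complex_of_real p * x) * of_real (Q (1 + t + p))"
      proof (cases "p \<ge> 0")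
        case True
        then show ?thesis using t by (intro tendsto_intros lim) auto
      qed simp
    qed
    show "AE p in lborel. norm (indicator {0..} p *\<^sub>R exp (- complex_of_real p * x) * of_real (q n (1 + t + p)))
        \<le> 1 / (1 + t) * (indicator {0..} p * exp (- p * Re x))" for n
      by (intro AE_I2 laplace_dominated_kernel_bound q t)
  qed (use integrable_laplace_dominated[OF x q t] integrable_laplace_dominated[OF x Q t] in auto)
  then show ?thesis
    unfolding laplace_defect_def using x t by (intro tendsto_intros lim) auto
qed

section \<open>Stieltjes transforms\<close>

text \<open>What the series argument requires of the normalised measure \<open>F(t) dt\<close>:
  support in the half-line and integrability of \<open>1 / (1 + t)\<close>. The latter yields the
  transform on \<open>Re p > -1\<close> and every majorant below.\<close>

locale stieltjes_measure = sigma_finite_measure \<nu> for \<nu> :: "real measure" +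
  assumes sets_nu [measurable_cong, simp]: "sets \<nu> = sets borel"
    and nonneg: "AE t in \<nu>. 0 \<le> t"
    and integrable_nu: "integrable \<nu> (\<lambda>t. 1 / (1 + t))"
begin

definition stieltjes :: "complex \<Rightarrow> complex" where
  "stieltjes p = (\<integral>t. 1 / (1 + of_real t + p) \<partial>\<nu>)"

definition defect :: "complex \<Rightarrow> (real \<Rightarrow> real) \<Rightarrow> complex" where
  "defect x q = (\<integral>t. laplace_defect x q t \<partial>\<nu>)"

lemma integrable_laplace_defect:
  assumes x: "Re x > 0" and q: "laplace_dominated q"
  shows "integrable \<nu> (laplace_defect x q)"
proof (rule Bochner_Integration.integrable_bound)
  show "integrable \<nu> (\<lambda>t. (1 / norm x + 1 / Re x) * (1 / (1 + t)))"
    by (rule integrable_mult_right[OF integrable_nu])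
  show "AE t in \<nu>. norm (laplace_defect x q t) \<le> norm ((1 / norm x + 1 / Re x) * (1 / (1 + t)))"
    using nonneg
  proof eventually_elim
    case (elim t)
    show ?case
      unfolding real_norm_def by (rule order_trans[OF norm_laplace_defect_le[OF x q elim] abs_ge_self])
  qed
qed (use borel_measurable_laplace_defect[OF q] in simp)

text \<open>Assumption \<open>part\<close> places all partial sums under \<open>1 / y\<close>, so
  dominated convergence applies twice: in \<open>p\<close> inside \<open>laplace_defect\<close>,
  then in \<open>t\<close>.\<close>

lemma defect_sums:
  assumes x: "Re x > 0" and q: "\<And>k. laplace_dominated (q k)" and Q: "laplace_dominated Q"
    and part: "\<And>n. laplace_dominated (\<lambda>y. \<Sum>k<n. q k y)"
    and sums: "\<And>y. y \<ge> 1 \<Longrightarrow> (\<lambda>k. q k y) sums Q y"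
  shows "(\<lambda>k. defect x (q k)) sums defect x Q"
proof -
  have "(\<lambda>n. defect x (\<lambda>y. \<Sum>k<n. q k y)) \<longlonglongrightarrow> defect x Q"
    unfolding defect_def
  proof (rule integral_dominated_convergence)
    show "integrable \<nu> (\<lambda>t. (1 / norm x + 1 / Re x) * (1 / (1 + t)))"
      by (rule integrable_mult_right[OF integrable_nu])
    show "AE t in \<nu>. (\<lambda>n. laplace_defect x (\<lambda>y. \<Sum>k<n. q k y) t) \<longlonglongrightarrow> laplace_defect x Q t"
      using nonneg
      by eventually_elim (intro laplace_defect_tendsto x part Q, use sums in \<open>auto simp: sums_def\<close>)
    show "AE t in \<nu>. norm (laplace_defect x (\<lambda>y. \<Sum>k<n. q k y) t) \<le> (1 / norm x + 1 / Re x) * (1 / (1 + t))" for n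
      using nonneg by eventually_elim (rule norm_laplace_defect_le[OF x part])
  qed (use borel_measurable_laplace_defect[OF part] borel_measurable_laplace_defect[OF Q] in auto)
  moreover have "defect x (\<lambda>y. \<Sum>k<n. q k y) = (\<Sum>k<n. defect x (q k))" for n
  proof -
    have "defect x (\<lambda>y. \<Sum>k<n. q k y) = (\<integral>t. (\<Sum>k<n. laplace_defect x (q k) t) \<partial>\<nu>)"
      unfolding defect_def
    proof (rule integral_cong_AE)
      show "AE t in \<nu>. laplace_defect x (\<lambda>y. \<Sum>k<n. q k y) t = (\<Sum>k<n. laplace_defect x (q k) t)"
        using nonneg by eventually_elim (rule laplace_defect_sum[OF x q])
    qed (use borel_measurable_laplace_defect[OF part] borel_measurable_laplace_defect[OF q] in auto)
    also have "\<dots> = (\<Sum>k<n. defect x (q k))"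
      unfolding defect_def by (rule Bochner_Integration.integral_sum) (rule integrable_laplace_defect[OF x q])
    finally show ?thesis .
  qed
  ultimately show ?thesis by (simp only: sums_def)
qed

text \<open>Fubini: for fixed \<open>t\<close> the inner Laplace integral of
  \<open>1 / (1 + t + p)\<close> is \<open>1 / ((1 + t) x)\<close> minus the defect, and its
  absolute version is at most \<open>1 / (Re x (1 + t))\<close>, which is integrable. The first part
  contributes the term \<open>F(0) / x\<close> of the theorem.\<close>

lemma laplace_stieltjes:
  assumes x: "Re x > 0"
  shows "(\<integral>p. indicator {0..} p *\<^sub>R exp (- complex_of_real p * x) * stieltjes (of_real p) \<partial>lborel) =
           stieltjes 0 / x - defect x (\<lambda>y. 1 / y)"
proof -
  let ?k = "\<lambda>p. indicator {0..} p *\<^sub>R exp (- complex_of_real p * x)"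
  let ?f = "\<lambda>t p. ?k p * of_real (1 / (1 + t + p))"
  interpret P: pair_sigma_finite \<nu> lborel ..
  note dom = laplace_dominated_inverse
  have int_f: "integrable lborel (?f t)" if "t \<ge> 0" for t
    by (rule integrable_laplace_dominated[OF x dom that])
  have [measurable]: "(\<lambda>z. ?f (fst z) (snd z)) \<in> borel_measurable (\<nu> \<Otimes>\<^sub>M lborel)"
    by measurable
  have "integrable (\<nu> \<Otimes>\<^sub>M lborel) (\<lambda>z. ?f (fst z) (snd z))"
  proof (rule P.Fubini_integrable)
    show "AE t in \<nu>. integrable lborel (\<lambda>p. ?f (fst (t, p)) (snd (t, p)))"
      using nonneg by eventually_elim (use int_f in simp)
    show "integrable \<nu> (\<lambda>t. \<integral>p. norm (?f (fst (t, p)) (snd (t, p))) \<partial>lborel)"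
    proof (rule Bochner_Integration.integrable_bound)
      show "integrable \<nu> (\<lambda>t. 1 / Re x * (1 / (1 + t)))"
        by (rule integrable_mult_right[OF integrable_nu])
      show "(\<lambda>t. \<integral>p. norm (?f (fst (t, p)) (snd (t, p))) \<partial>lborel) \<in> borel_measurable \<nu>"
        by measurable
      show "AE t in \<nu>. norm (\<integral>p. norm (?f (fst (t, p)) (snd (t, p))) \<partial>lborel) \<le> norm (1 / Re x * (1 / (1 + t)))"
        using nonneg
      proof eventually_elim
        case (elim t)
        note g = has_bochner_integral_mult_right[OF has_bochner_integral_exp_minus[OF x], of "1 / (1 + t)"]
        have "(\<integral>p. norm (?f t p) \<partial>lborel) \<le> (\<integral>p. 1 / (1 + t) * (indicator {0..} p * exp (- p * Re x)) \<partial>lborel)"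
          by (rule integral_mono[OF integrable_norm[OF int_f[OF elim]]])
             (use g laplace_dominated_kernel_bound[OF dom elim] in \<open>auto simp: has_bochner_integral_iff\<close>)
        also have "\<dots> = 1 / Re x * (1 / (1 + t))"
          using g by (simp only: has_bochner_integral_iff mult.commute)
        finally have "(\<integral>p. norm (?f t p) \<partial>lborel) \<le> 1 / Re x * (1 / (1 + t))" .
        moreover have "0 \<le> (\<integral>p. norm (?f t p) \<partial>lborel)"
          by (rule Bochner_Integration.integral_nonneg) simp
        ultimately show ?case
          by (simp only: real_norm_def fst_conv snd_conv)
      qed
    qed
  qed measurable
  then have fub: "(\<integral>p. (\<integral>t. ?f t p \<partial>\<nu>) \<partial>lborel) = (\<integral>t. (\<integral>p. ?f t p \<partial>lborel) \<partial>\<nu>)"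
    by (intro P.Fubini_integral) (simp only: case_prod_unfold)
  have int_t: "integrable \<nu> (\<lambda>t. \<integral>p. ?f t p \<partial>lborel)"
    using P.integrable_fst'[OF \<open>integrable (\<nu> \<Otimes>\<^sub>M lborel) (\<lambda>z. ?f (fst z) (snd z))\<close>]
    by (simp only: fst_conv snd_conv)
  have st: "(\<integral>t. of_real (1 / (1 + t + p)) \<partial>\<nu>) = stieltjes (of_real p)" for p
    unfolding stieltjes_def by (rule Bochner_Integration.integral_cong) simp_all
  have "(\<integral>p. ?k p * stieltjes (of_real p) \<partial>lborel) = (\<integral>p. (\<integral>t. ?f t p \<partial>\<nu>) \<partial>lborel)"
    by (simp only: integral_mult_right_zero st)
  also have "\<dots> = (\<integral>t. (\<integral>p. ?f t p \<partial>lborel) \<partial>\<nu>)" by (rule fub)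
  also have "\<dots> = (\<integral>t. of_real (1 / (1 + t)) / x - laplace_defect x (\<lambda>y. 1 / y) t \<partial>\<nu>)"
    by (simp only: laplace_defect_def diff_diff_eq2 add_diff_cancel_left')
  also have "\<dots> = (\<integral>t. of_real (1 / (1 + t)) / x \<partial>\<nu>) - defect x (\<lambda>y. 1 / y)"
    unfolding defect_def
    by (intro Bochner_Integration.integral_diff integrable_laplace_defect x dom
        integrable_divide_zero integrable_of_real impI integrable_nu)
  also have "(\<integral>t. of_real (1 / (1 + t)) / x \<partial>\<nu>) = stieltjes 0 / x"
    unfolding integral_divide_zero using st[of 0] by simp
  finally show ?thesis .
qed

end

section \<open>Analyticity and Taylor expansion of the Stieltjes transform\<close>

context stieltjes_measure
begin

lemma stieltjes_holomorphic: "stieltjes holomorphic_on {p. Re p > -1}"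
proof (rule holomorphic_onI)
  fix z0 :: complex assume "z0 \<in> {p. Re p > -1}"
  then have z0: "Re z0 > -1" by simp
  \<comment> \<open>\<open>r\<close> is half the distance from \<open>z0\<close> to the line
    \<open>Re p = -1\<close>, so \<open>1 + Re z > r\<close> on the ball. Taking
    \<open>m \<le> 1\<close> as well gives \<open>t \<ge> m t\<close>, hence
    \<open>norm (1 + t + z) \<ge> m (1 + t)\<close> uniformly in \<open>t\<close>.\<close>
  define r where "r = (1 + Re z0) / 2"
  define m where "m = min r 1"
  have r: "r > 0" using z0 by (simp add: r_def)
  have m: "0 < m" "m \<le> 1" "m \<le> r" using r by (auto simp: m_def)
  have lower: "norm (1 + of_real t + z) \<ge> m * (1 + t)" if "z \<in> ball z0 r" "t \<ge> 0" for z t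
  proof -
    have "Re (z0 - z) \<le> norm (z0 - z)" by (rule complex_Re_le_cmod)
    then have "Re z0 - Re z < r" using that by (simp add: dist_norm)
    then have "1 + Re z > r" by (simp add: r_def field_simps)
    moreover have "m * t \<le> 1 * t" using m that by (intro mult_right_mono) auto
    ultimately have "m * (1 + t) \<le> Re (1 + of_real t + z)" using m by (simp add: algebra_simps)
    then show ?thesis using complex_Re_le_cmod order_trans by blast
  qed
  have nz: "1 + of_real t + z \<noteq> 0" if "z \<in> ball z0 r" "t \<ge> 0" for z t
  proof -
    have "0 < m * (1 + t)" using m that by (intro mult_pos_pos) auto
    with lower[OF that] have "0 < norm (1 + of_real t + z)" by linarith
    then show ?thesis by (rule zero_less_norm_iff[THEN iffD1])
  qed
  have inv: "norm (1 / (1 + of_real t + z)) \<le> 1 / m * (1 / (1 + t))"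
    if "z \<in> ball z0 r" "t \<ge> 0" for z t
  proof -
    have "1 / norm (1 + of_real t + z) \<le> 1 / (m * (1 + t))"
      using lower[OF that] nz[OF that] m that by (intro divide_left_mono mult_pos_pos) auto
    then show ?thesis by (simp add: norm_divide)
  qed
  have "((\<lambda>z. \<integral>t. 1 / (1 + of_real t + z) \<partial>\<nu>) has_field_derivative
          (\<integral>t. - ((1 / (1 + of_real t + z0))\<^sup>2) \<partial>\<nu>)) (at z0)"
  proof (rule has_field_derivative_integral[OF r])
    show "integrable \<nu> (\<lambda>t. 1 / (1 + of_real t + z))" if "z \<in> ball z0 r" for z
    proof (rule Bochner_Integration.integrable_bound)
      show "integrable \<nu> (\<lambda>t. 1 / m * (1 / (1 + t)))"
        by (rule integrable_mult_right[OF integrable_nu])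
      show "AE t in \<nu>. norm (1 / (1 + of_real t + z)) \<le> norm (1 / m * (1 / (1 + t)))"
        using nonneg
      proof eventually_elim
        case (elim t)
        show ?case unfolding real_norm_def by (rule order_trans[OF inv[OF that elim] abs_ge_self])
      qed
    qed measurable
    show "(\<lambda>t. - ((1 / (1 + of_real t + z0))\<^sup>2)) \<in> borel_measurable \<nu>"
      by measurable
    show "AE t in \<nu>. \<forall>z\<in>ball z0 r. ((\<lambda>z. 1 / (1 + of_real t + z)) has_field_derivative
        - ((1 / (1 + of_real t + z))\<^sup>2)) (at z)"
      using nonneg
    proof eventually_elim
      case (elim t)
      show ?case
      proof
        fix z assume "z \<in> ball z0 r"
        then have "1 + of_real t + z \<noteq> 0" by (rule nz) (rule elim)
        then show "((\<lambda>z. 1 / (1 + of_real t + z)) has_field_derivative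
            - ((1 / (1 + of_real t + z))\<^sup>2)) (at z)"
          by (auto intro!: derivative_eq_intros simp: power2_eq_square)
      qed
    qed
    show "AE t in \<nu>. \<forall>z\<in>ball z0 r. norm (- ((1 / (1 + of_real t + z))\<^sup>2)) \<le> (1 / m)\<^sup>2 * (1 / (1 + t))"
      using nonneg
    proof eventually_elim
      case (elim t)
      show ?case
      proof
        fix z assume "z \<in> ball z0 r"
        then have "norm (1 / (1 + of_real t + z)) \<le> 1 / m * (1 / (1 + t))" by (rule inv) (rule elim)
        then have "(norm (1 / (1 + of_real t + z)))\<^sup>2 \<le> (1 / m * (1 / (1 + t)))\<^sup>2"
          by (intro power_mono) auto
        also have "\<dots> = (1 / m)\<^sup>2 * (1 / (1 + t))\<^sup>2" by (rule power_mult_distrib)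
        also have "\<dots> \<le> (1 / m)\<^sup>2 * (1 / (1 + t))"
          unfolding power2_eq_square[of "1 / (1 + t)"] using elim
          by (intro mult_left_mono mult_left_le) auto
        finally show "norm (- ((1 / (1 + of_real t + z))\<^sup>2)) \<le> (1 / m)\<^sup>2 * (1 / (1 + t))"
          by (simp only: norm_minus_cancel norm_power)
      qed
    qed
  qed (rule integrable_mult_right[OF integrable_nu])
  then have "(stieltjes has_field_derivative (\<integral>t. - ((1 / (1 + of_real t + z0))\<^sup>2) \<partial>\<nu>)) (at z0)"
    by (simp only: stieltjes_def[abs_def])
  then show "stieltjes field_differentiable at z0 within {p. Re p > -1}"
    using field_differentiable_at_within field_differentiable_def by blast
qed

lemma integrable_moment: "integrable \<nu> (\<lambda>t. 1 / (1 + t) ^ Suc n)"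
proof (rule Bochner_Integration.integrable_bound[OF integrable_nu])
  show "AE t in \<nu>. norm (1 / (1 + t) ^ Suc n) \<le> norm (1 / (1 + t))"
    using nonneg
  proof eventually_elim
    case (elim t)
    have "(1 / (1 + t)) ^ Suc n \<le> (1 / (1 + t)) ^ 1"
      using elim by (intro power_decreasing) auto
    then show ?case using elim by (simp add: power_divide)
  qed
qed measurable

text \<open>Geometric series in \<open>- p / (1 + t)\<close>, whose modulus is at most
  \<open>norm p < 1\<close>. It turns the moments of the measure into Taylor coefficients.\<close>

lemma stieltjes_sums:
  assumes p: "norm p < 1"
  shows "(\<lambda>n. (- p) ^ n * of_real (\<integral>t. 1 / (1 + t) ^ Suc n \<partial>\<nu>)) sums stieltjes p"
proof -
  let ?f = "\<lambda>n t. (- p) ^ n * complex_of_real (1 / (1 + t) ^ Suc n)"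
  have int: "integrable \<nu> (?f n)" for n
    by (intro integrable_mult_right integrable_of_real integrable_moment)
  have nf: "norm (?f n t) \<le> norm p ^ n * (1 / (1 + t))" if "t \<ge> 0" for n t
  proof -
    have "(1 / (1 + t)) ^ Suc n \<le> (1 / (1 + t)) ^ 1"
      using that by (intro power_decreasing) auto
    then have "norm p ^ n * (1 / (1 + t) ^ Suc n) \<le> norm p ^ n * (1 / (1 + t))"
      by (intro mult_left_mono) (auto simp: power_divide)
    then show ?thesis using that
      by (simp only: norm_mult norm_power norm_minus_cancel norm_of_real abs_divide abs_power2 power_abs abs_one)
  qed
  have S: "summable (\<lambda>n. norm p ^ n * B)" for B :: real
    using p by (intro summable_mult2 summable_geometric) auto
  have "(\<lambda>n. \<integral>t. ?f n t \<partial>\<nu>) sums (\<integral>t. (\<Sum>n. ?f n t) \<partial>\<nu>)"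
  proof (rule sums_integral[OF int])
    show "AE t in \<nu>. summable (\<lambda>n. norm (?f n t))"
      using nonneg
    proof eventually_elim
      case (elim t)
      show ?case
        by (rule summable_comparison_test'[OF S[of "1 / (1 + t)"], of 0])
           (use nf[OF elim] in \<open>simp only: real_norm_def abs_norm_cancel\<close>)
    qed
    show "summable (\<lambda>n. \<integral>t. norm (?f n t) \<partial>\<nu>)"
    proof (rule summable_comparison_test'[OF S[of "\<integral>t. 1 / (1 + t) \<partial>\<nu>"], of 0])
      fix n
      have "(\<integral>t. norm (?f n t) \<partial>\<nu>) \<le> (\<integral>t. norm p ^ n * (1 / (1 + t)) \<partial>\<nu>)"
      proof (rule integral_mono_AE[OF integrable_norm[OF int] integrable_mult_right[OF integrable_nu]])
        show "AE t in \<nu>. norm (?f n t) \<le> norm p ^ n * (1 / (1 + t))"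
          using nonneg by eventually_elim (rule nf)
      qed
      also have "\<dots> = norm p ^ n * (\<integral>t. 1 / (1 + t) \<partial>\<nu>)" by (rule integral_mult_right_zero)
      finally show "norm (\<integral>t. norm (?f n t) \<partial>\<nu>) \<le> norm p ^ n * (\<integral>t. 1 / (1 + t) \<partial>\<nu>)"
        by (subst real_norm_def, subst abs_of_nonneg) (rule Bochner_Integration.integral_nonneg, simp)
    qed
  qed
  also have "(\<lambda>n. \<integral>t. ?f n t \<partial>\<nu>) = (\<lambda>n. (- p) ^ n * of_real (\<integral>t. 1 / (1 + t) ^ Suc n \<partial>\<nu>))"
    by (simp only: integral_mult_right_zero integral_complex_of_real)
  also have "(\<integral>t. (\<Sum>n. ?f n t) \<partial>\<nu>) = stieltjes p"
    unfolding stieltjes_def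
  proof (rule integral_cong_AE)
    show "AE t in \<nu>. (\<Sum>n. ?f n t) = 1 / (1 + of_real t + p)"
      using nonneg
    proof eventually_elim
      case (elim t)
      define T where "T = complex_of_real (1 + t)"
      have T: "T \<noteq> 0" "norm T \<ge> 1" using elim by (auto simp: T_def simp del: of_real_add)
      have "norm (- p / T) < 1"
        using p T by (simp add: norm_divide divide_less_eq)
      then have "(\<lambda>n. 1 / T * (- p / T) ^ n) sums (1 / T * (1 / (1 - - p / T)))"
        by (intro sums_mult geometric_sums)
      also have "(\<lambda>n. 1 / T * (- p / T) ^ n) = (\<lambda>n. ?f n t)"
        unfolding power_divide by (simp add: T_def mult_ac)
      also have "1 / T * (1 / (1 - - p / T)) = 1 / (T + p)"
        using T by (simp add: field_simps)
      finally show ?case by (simp add: T_def sums_iff)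
    qed
  qed (use int in \<open>auto intro!: borel_measurable_suminf\<close>)
  finally show ?thesis .
qed

end

section \<open>The dyadic decomposition\<close>

text \<open>One formula for three roles: \<open>\<epsilon> = 1\<close>, \<open>l = 1\<close> is the
  starting term \<open>1 / (exp y - 1)\<close>; \<open>\<epsilon> = -1\<close>,
  \<open>l = 2 ^ k\<close> is the \<open>k\<close>-th summand; \<open>\<epsilon> = 1\<close>,
  \<open>l = 2 ^ n\<close> is the partial sum up to \<open>n\<close>, starting term
  included.\<close>

definition dyadic_kernel :: "real \<Rightarrow> real \<Rightarrow> real \<Rightarrow> real" where
  "dyadic_kernel \<epsilon> l y = 1 / (l * (exp (y / l) - \<epsilon>))"

lemma dyadic_kernel_bounds:
  assumes "l > 0" "\<epsilon> \<le> 1" "y > 0"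
  shows "0 \<le> dyadic_kernel \<epsilon> l y" "dyadic_kernel \<epsilon> l y \<le> 1 / y"
proof -
  have "y / l \<le> exp (y / l) - \<epsilon>" using exp_ge_add_one_self[of "y / l"] assms by linarith
  then have "y \<le> l * (exp (y / l) - \<epsilon>)" using assms by (simp add: field_simps)
  then show "0 \<le> dyadic_kernel \<epsilon> l y" "dyadic_kernel \<epsilon> l y \<le> 1 / y"
    using assms unfolding dyadic_kernel_def by (auto intro!: divide_left_mono)
qed

lemma laplace_dominated_dyadic_kernel:
  assumes "l > 0" "\<epsilon> \<le> 1"
  shows "laplace_dominated (dyadic_kernel \<epsilon> l)"
  unfolding laplace_dominated_def
proof
  show "dyadic_kernel \<epsilon> l \<in> borel_measurable borel"
    unfolding dyadic_kernel_def[abs_def] by measurable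
  show "\<forall>y\<ge>1. \<bar>dyadic_kernel \<epsilon> l y\<bar> \<le> 1 / y"
    using dyadic_kernel_bounds[OF assms] by auto
qed

text \<open>Telescopes by \<open>2 / (E\<^sup>2 - 1) = 1 / (E - 1) - 1 / (E + 1)\<close> with
  \<open>E = exp (y / 2 ^ Suc n)\<close>.\<close>

lemma dyadic_kernel_partial_sum:
  assumes "y > 0"
  shows "(\<Sum>k<n. dyadic_kernel (- 1) (2 ^ Suc k) y) = dyadic_kernel 1 (2 ^ n) y - dyadic_kernel 1 1 y"
proof (induction n)
  case (Suc n)
  define E where "E = exp (y / 2 ^ Suc n)"
  have E: "E > 1" "exp (y / 2 ^ n) = E\<^sup>2"
    using assms by (auto simp: E_def simp flip: exp_double)
  have "E\<^sup>2 - 1 = (E - 1) * (E + 1)" by (simp add: power2_eq_square algebra_simps)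
  then have "dyadic_kernel 1 (2 ^ n) y + dyadic_kernel (- 1) (2 ^ Suc n) y = dyadic_kernel 1 (2 ^ Suc n) y"
    unfolding dyadic_kernel_def E(2) E_def[symmetric] using E(1)
    by (simp add: divide_simps, simp add: algebra_simps)
  with Suc show ?case by simp
qed simp

lemma dyadic_kernel_tendsto:
  assumes "y > 0"
  shows "(\<lambda>n. dyadic_kernel 1 (2 ^ n) y) \<longlonglongrightarrow> 1 / y"
proof -
  have lim: "(\<lambda>n. y / 2 ^ n) \<longlonglongrightarrow> 0"
    using tendsto_mult_right_zero[OF LIMSEQ_power_zero[of "1 / 2 :: real"], of y] by (simp add: power_divide)
  have "filterlim (\<lambda>n. y / 2 ^ n) (at 0) sequentially"
    unfolding filterlim_at using lim assms by auto
  then have "(\<lambda>n. (exp (y / 2 ^ n) - 1) / (y / 2 ^ n)) \<longlonglongrightarrow> 1"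
    by (rule filterlim_compose[OF lim_exp_minus_1])
  then have "(\<lambda>n. 1 / (y * ((exp (y / 2 ^ n) - 1) / (y / 2 ^ n)))) \<longlonglongrightarrow> 1 / (y * 1)"
    using assms by (intro tendsto_intros) auto
  moreover have "1 / (y * ((exp (y / 2 ^ n) - 1) / (y / 2 ^ n))) = dyadic_kernel 1 (2 ^ n) y" for n
    using assms by (simp add: dyadic_kernel_def)
  ultimately show ?thesis by simp
qed

lemma dyadic_kernel_sums:
  assumes "y > 0"
  shows "(\<lambda>k. dyadic_kernel (- 1) (2 ^ Suc k) y) sums (1 / y - dyadic_kernel 1 1 y)"
  unfolding sums_def dyadic_kernel_partial_sum[OF assms]
  by (intro tendsto_intros dyadic_kernel_tendsto assms)

context stieltjes_measure
begin

lemma defect_dyadic_sums: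
  assumes x: "Re x > 0"
  shows "(\<lambda>k. defect x (dyadic_kernel (- 1) (2 ^ Suc k))) sums
           (defect x (\<lambda>y. 1 / y) - defect x (dyadic_kernel 1 1))"
proof -
  \<comment> \<open>The starting term is put at index 0, so that every nonempty partial sum is a
    single kernel \<open>dyadic_kernel 1 (2 ^ n)\<close> and therefore below \<open>1 / y\<close>.
    It is split off again at the end.\<close>
  let ?q = "\<lambda>k. if k = 0 then dyadic_kernel 1 1 else dyadic_kernel (- 1) (2 ^ k)"
  have sum: "(\<Sum>k<Suc n. ?q k y) = dyadic_kernel 1 (2 ^ n) y" if "y > 0" for n y
    using dyadic_kernel_partial_sum[OF that, of n] by (subst sum.lessThan_Suc_shift) simp
  have dom: "laplace_dominated (?q k)" for k
    by (auto intro!: laplace_dominated_dyadic_kernel)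
  have "(\<lambda>k. defect x (?q k)) sums defect x (\<lambda>y. 1 / y)"
  proof (rule defect_sums[OF x dom laplace_dominated_inverse])
    show "laplace_dominated (\<lambda>y. \<Sum>k<n. ?q k y)" for n
      unfolding laplace_dominated_def
    proof (intro conjI allI impI)
      show "(\<lambda>y. \<Sum>k<n. ?q k y) \<in> borel_measurable borel"
        using dom by (intro borel_measurable_sum) (auto simp: laplace_dominated_def)
      fix y :: real assume y: "y \<ge> 1"
      show "\<bar>\<Sum>k<n. ?q k y\<bar> \<le> 1 / y"
      proof (cases n)
        case (Suc m)
        have "\<bar>dyadic_kernel 1 (2 ^ m) y\<bar> \<le> 1 / y"
          using dyadic_kernel_bounds[of "2 ^ m" 1 y] y by auto
        then show ?thesis using sum[of y m] y Suc by simp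
      qed (use y in simp)
    qed
    show "(\<lambda>k. ?q k y) sums (1 / y)" if "y \<ge> 1" for y
    proof -
      have "(\<lambda>k. ?q (Suc k) y) sums (1 / y - ?q 0 y)"
        using dyadic_kernel_sums[of y] that by simp
      then show ?thesis by (subst (asm) sums_Suc_iff) simp
    qed
  qed
  then have "(\<lambda>k. defect x (?q (Suc k))) sums (defect x (\<lambda>y. 1 / y) - defect x (?q 0))"
    by (subst sums_Suc_iff) simp
  then show ?thesis by simp
qed

text \<open>The substitution \<open>p \<mapsto> l p\<close> brings the kernel to the form of
  \<open>laplace_factorial_series\<close> with \<open>L = exp ((1 + t) / l)\<close> and
  \<open>l x\<close> in place of \<open>x\<close>; the series obtained at each \<open>t\<close> is
  then integrated. Assumption \<open>lc\<close> gives the geometric ratio \<open>1 / c\<close>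
  uniformly in \<open>t\<close>, and \<open>l2\<close> gives
  \<open>L - \<epsilon> \<ge> L / 2\<close>.\<close>

lemma defect_dyadic_kernel_sums:
  fixes l \<epsilon> c :: real and x :: complex
  assumes x: "Re x > 0" and l: "l > 0" and \<epsilon>: "\<epsilon>\<^sup>2 = 1" and c: "c > 1"
    and lc: "exp (1 / l) - \<epsilon> \<ge> c" and l2: "exp (1 / l) \<ge> 2 * \<epsilon>"
  defines "D \<equiv> \<lambda>m t. exp ((1 + t) / l) / (exp ((1 + t) / l) - \<epsilon>) ^ m"
  shows "integrable \<nu> (D (i + 2))"
    and "(\<lambda>i. (- of_real \<epsilon>) ^ (i + 2) * fact (Suc i) / pochhammer (of_real l * x) (i + 2) *
            of_real (\<integral>t. D (i + 2) t \<partial>\<nu>)) sums defect x (dyadic_kernel \<epsilon> l)"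
proof -
  let ?X = "of_real l * x"
  have X: "Re ?X > 0" using x l by simp
  have D_meas [measurable]: "D m \<in> borel_measurable borel" for m
    unfolding D_def by measurable
  define L where "L = (\<lambda>t. exp ((1 + t) / l))"
  have L: "L t - \<epsilon> \<ge> c" "L t \<ge> 2 * \<epsilon>" "L t > 0" if "t \<ge> 0" for t
  proof -
    have "1 / l \<le> (1 + t) / l" using l that by (intro divide_right_mono) auto
    then have "exp (1 / l) \<le> L t" by (simp add: L_def)
    then show "L t - \<epsilon> \<ge> c" "L t \<ge> 2 * \<epsilon>" using lc l2 by auto
  qed (simp add: L_def)
  have D_nonneg: "0 \<le> D (i + 2) t" if "t \<ge> 0" for i t
  proof -
    have "0 < exp ((1 + t) / l) - \<epsilon>" using L[OF that] c by (simp add: L_def)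
    then show ?thesis unfolding D_def by (intro divide_nonneg_nonneg zero_le_power) auto
  qed
  \<comment> \<open>Two of the factors in the denominator are spent on decay in \<open>t\<close>:
    \<open>L / (L - \<epsilon>)\<^sup>2 \<le> 4 / L \<le> 4 l / (1 + t)\<close>, the last step by
    \<open>exp s \<ge> s\<close>. The other \<open>i\<close> factors give
    \<open>(1 / c) ^ i\<close>.\<close>
  have D_le: "D (i + 2) t \<le> (1 / c) ^ i * (4 * l * (1 / (1 + t)))" if "t \<ge> 0" for i t
  proof -
    note L = L[OF that]
    have pos: "0 < L t - \<epsilon>" using L c by simp
    have "(1 + t) / l \<le> L t" unfolding L_def using exp_ge_add_one_self[of "(1 + t) / l"] by linarith
    then have "1 / L t \<le> 1 / ((1 + t) / l)"
      using that l L by (intro divide_left_mono mult_pos_pos divide_pos_pos) auto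
    then have 1: "4 * (1 / L t) \<le> 4 * l * (1 / (1 + t))" by simp
    have "(L t / 2)\<^sup>2 \<le> (L t - \<epsilon>)\<^sup>2" using L by (intro power_mono) auto
    then have "L t / (L t - \<epsilon>)\<^sup>2 \<le> L t / (L t / 2)\<^sup>2"
      using L pos by (intro divide_left_mono) auto
    also have "\<dots> = 4 * (1 / L t)" using L by (simp add: power2_eq_square)
    finally have 2: "L t / (L t - \<epsilon>)\<^sup>2 \<le> 4 * l * (1 / (1 + t))" using 1 by linarith
    have "1 / (L t - \<epsilon>) \<le> 1 / c" using L c by (intro divide_left_mono) auto
    then have "(1 / (L t - \<epsilon>)) ^ i \<le> (1 / c) ^ i" using pos by (intro power_mono) auto
    then have "(1 / (L t - \<epsilon>)) ^ i * (L t / (L t - \<epsilon>)\<^sup>2) \<le> (1 / c) ^ i * (4 * l * (1 / (1 + t)))"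
      using 2 c L by (intro mult_mono) auto
    also have "(1 / (L t - \<epsilon>)) ^ i * (L t / (L t - \<epsilon>)\<^sup>2) = D (i + 2) t"
      unfolding D_def L_def by (simp add: power_divide power_add power2_eq_square mult_ac)
    finally show ?thesis .
  qed
  show int_D: "integrable \<nu> (D (i + 2))" for i
  proof (rule Bochner_Integration.integrable_bound)
    show "integrable \<nu> (\<lambda>t. (1 / c) ^ i * (4 * l * (1 / (1 + t))))"
      by (intro integrable_mult_right integrable_nu)
    show "AE t in \<nu>. norm (D (i + 2) t) \<le> norm ((1 / c) ^ i * (4 * l * (1 / (1 + t))))"
      using nonneg
    proof eventually_elim
      case (elim t)
      show ?case
        unfolding real_norm_def abs_of_nonneg[OF D_nonneg[OF elim]]
        by (rule order_trans[OF D_le[OF elim] abs_ge_self])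
    qed
  qed measurable
  let ?a = "\<lambda>i. (- of_real \<epsilon>) ^ (i + 2) * fact (Suc i) / pochhammer ?X (i + 2)"
  let ?f = "\<lambda>i t. ?a i * complex_of_real (D (i + 2) t)"
  have abs\<epsilon>: "\<bar>\<epsilon>\<bar> = 1" using \<epsilon> by (auto simp: power2_eq_1_iff)
  have a_le: "norm (?a i) \<le> 1 / Re ?X" for i
  proof -
    have "?a i = (- of_real \<epsilon>) ^ (i + 2) * (fact (Suc i) / pochhammer ?X (Suc (Suc i)))"
      by simp
    then have "norm (?a i) = norm (fact (Suc i) / pochhammer ?X (Suc (Suc i)))"
      using abs\<epsilon> by (simp only: norm_mult norm_power norm_minus_cancel norm_of_real power_one mult_1)
    then show ?thesis using norm_fact_div_pochhammer_le[OF X, of "Suc i"] by (simp only:)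
  qed
  have int_f: "integrable \<nu> (?f i)" for i
    by (intro integrable_mult_right integrable_of_real int_D)
  have nf: "norm (?f i t) \<le> 1 / Re ?X * ((1 / c) ^ i * (4 * l * (1 / (1 + t))))" if "t \<ge> 0" for i t
    unfolding norm_mult[of "?a i"] norm_of_real abs_of_nonneg[OF D_nonneg[OF that]]
    using a_le[of i] D_le[OF that, of i] D_nonneg[OF that, of i] X
    by (intro mult_mono) auto
  have S: "summable (\<lambda>i. 1 / Re ?X * ((1 / c) ^ i * B))" for B
    using c by (intro summable_mult summable_mult2 summable_geometric) auto
  have "(\<lambda>i. \<integral>t. ?f i t \<partial>\<nu>) sums (\<integral>t. (\<Sum>i. ?f i t) \<partial>\<nu>)"
  proof (rule sums_integral[OF int_f])
    show "AE t in \<nu>. summable (\<lambda>i. norm (?f i t))"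
      using nonneg
    proof eventually_elim
      case (elim t)
      show ?case
        by (rule summable_comparison_test'[OF S[of "4 * l * (1 / (1 + t))"], of 0])
           (use nf[OF elim] in \<open>simp only: real_norm_def abs_norm_cancel\<close>)
    qed
    show "summable (\<lambda>i. \<integral>t. norm (?f i t) \<partial>\<nu>)"
    proof (rule summable_comparison_test'[OF S[of "4 * l * (\<integral>t. 1 / (1 + t) \<partial>\<nu>)"], of 0])
      fix i
      have "(\<integral>t. norm (?f i t) \<partial>\<nu>) \<le> (\<integral>t. 1 / Re ?X * ((1 / c) ^ i * (4 * l * (1 / (1 + t)))) \<partial>\<nu>)"
      proof (rule integral_mono_AE)
        show "AE t in \<nu>. norm (?f i t) \<le> 1 / Re ?X * ((1 / c) ^ i * (4 * l * (1 / (1 + t))))"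
          using nonneg by eventually_elim (rule nf)
      qed (intro integrable_norm int_f integrable_mult_right integrable_nu)+
      also have "\<dots> = 1 / Re ?X * ((1 / c) ^ i * (4 * l * (\<integral>t. 1 / (1 + t) \<partial>\<nu>)))"
        by (simp only: integral_mult_right_zero)
      finally show "norm (\<integral>t. norm (?f i t) \<partial>\<nu>) \<le> 1 / Re ?X * ((1 / c) ^ i * (4 * l * (\<integral>t. 1 / (1 + t) \<partial>\<nu>)))"
        by (subst real_norm_def, subst abs_of_nonneg) (rule Bochner_Integration.integral_nonneg, simp)
    qed
  qed
  also have "(\<lambda>i. \<integral>t. ?f i t \<partial>\<nu>) = (\<lambda>i. ?a i * of_real (\<integral>t. D (i + 2) t \<partial>\<nu>))"
    by (simp only: integral_mult_right_zero integral_complex_of_real)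
  also have "(\<integral>t. (\<Sum>i. ?f i t) \<partial>\<nu>) = defect x (dyadic_kernel \<epsilon> l)"
    unfolding defect_def
  proof (rule integral_cong_AE)
    show "AE t in \<nu>. (\<Sum>i. ?f i t) = laplace_defect x (dyadic_kernel \<epsilon> l) t"
      using nonneg
    proof eventually_elim
      case (elim t)
      have "L t - \<epsilon> > 1" using L[OF elim] c by simp
      from laplace_factorial_series[OF X \<epsilon> this]
      have "(\<lambda>i. ?f i t) sums (of_real (1 / (L t - \<epsilon>)) / ?X -
          (\<integral>p. indicator {0..} p *\<^sub>R exp (- complex_of_real p * ?X) * of_real (1 / (L t * exp p - \<epsilon>)) \<partial>lborel))"
        by (simp add: D_def L_def mult_ac)
      moreover have "of_real (1 / (L t - \<epsilon>)) / ?X = of_real (dyadic_kernel \<epsilon> l (1 + t)) / x"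
        by (simp add: dyadic_kernel_def L_def)
      moreover have "(\<integral>p. indicator {0..} p *\<^sub>R exp (- complex_of_real p * x) *
            of_real (dyadic_kernel \<epsilon> l (1 + t + p)) \<partial>lborel) =
          (\<integral>p. indicator {0..} p *\<^sub>R exp (- complex_of_real p * ?X) * of_real (1 / (L t * exp p - \<epsilon>)) \<partial>lborel)"
      proof -
        have "(\<integral>p. indicator {0..} p *\<^sub>R exp (- complex_of_real p * x) *
            of_real (dyadic_kernel \<epsilon> l (1 + t + p)) \<partial>lborel) =
          \<bar>l\<bar> *\<^sub>R (\<integral>p. indicator {0..} (0 + l * p) *\<^sub>R exp (- complex_of_real (0 + l * p) * x) *
            of_real (dyadic_kernel \<epsilon> l (1 + t + (0 + l * p))) \<partial>lborel)"
          using l by (intro lborel_integral_real_affine) simp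
        also have "\<dots> = (\<integral>p. \<bar>l\<bar> *\<^sub>R (indicator {0..} (0 + l * p) *\<^sub>R exp (- complex_of_real (0 + l * p) * x) *
            of_real (dyadic_kernel \<epsilon> l (1 + t + (0 + l * p)))) \<partial>lborel)"
          by (rule integral_scaleR_right[symmetric])
        also have "\<dots> = (\<integral>p. indicator {0..} p *\<^sub>R exp (- complex_of_real p * ?X) * of_real (1 / (L t * exp p - \<epsilon>)) \<partial>lborel)"
        proof (rule Bochner_Integration.integral_cong[OF refl])
          fix p :: real
          \<comment> \<open>The prefactor \<open>1 / l\<close> of the kernel cancels the Jacobian
            \<open>l\<close> of the substitution.\<close>
          have "(1 + t + l * p) / l = (1 + t) / l + p" using l by (simp add: field_simps)
          then have "dyadic_kernel \<epsilon> l (1 + t + l * p) = 1 / l * (1 / (L t * exp p - \<epsilon>))"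
            unfolding dyadic_kernel_def L_def by (simp add: exp_add)
          moreover have "indicator {0..} (l * p) = (indicator {0..} p :: real)"
            using l by (simp add: indicator_def zero_le_mult_iff)
          moreover have "- complex_of_real (l * p) * x = - complex_of_real p * ?X"
            by (simp add: mult_ac)
          ultimately show "\<bar>l\<bar> *\<^sub>R (indicator {0..} (0 + l * p) *\<^sub>R exp (- complex_of_real (0 + l * p) * x) *
            of_real (dyadic_kernel \<epsilon> l (1 + t + (0 + l * p)))) =
            indicator {0..} p *\<^sub>R exp (- complex_of_real p * ?X) * of_real (1 / (L t * exp p - \<epsilon>))"
            using l by (simp only: add_0_left of_real_mult) (simp add: scaleR_conv_of_real)
        qed
        finally show ?thesis .
      qed
      ultimately show ?case unfolding laplace_defect_def by (simp only: sums_iff)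
    qed
    have "\<epsilon> \<le> 1" using abs\<epsilon> by simp
    then show "laplace_defect x (dyadic_kernel \<epsilon> l) \<in> borel_measurable \<nu>"
      using borel_measurable_laplace_defect[OF laplace_dominated_dyadic_kernel[OF l]] by simp
  qed measurable
  finally show "(\<lambda>i. ?a i * of_real (\<integral>t. D (i + 2) t \<partial>\<nu>)) sums defect x (dyadic_kernel \<epsilon> l)" .
qed

end

section \<open>The self-reproducing property\<close>

text \<open>The normalisation makes the moment of \<open>1 / (1 + t) ^ Suc n\<close> equal to the
  \<open>n\<close>-th coefficient of \<open>\<^sub>2F\<^sub>1(a, 1 - a; 1; \<cdot>)\<close>, without
  a constant.\<close>

definition euler_measure :: "real \<Rightarrow> real measure" where
  "euler_measure a = density lborel
     (\<lambda>t. ennreal (indicator {0..} t * euler_fun a t / (Gamma a * Gamma (1 - a))))"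

lemma Gamma_mult_reflection_pos:
  assumes "0 < a" "a < (1 :: real)"
  shows "Gamma a * Gamma (1 - a) > 0"
  using assms by (intro mult_pos_pos Gamma_real_pos) auto

text \<open>Bridge between real integrals against the measure, used in the locale, and the complex
  set integrals by which \<open>d\<close> and \<open>dyadic_d\<close> are defined.\<close>

lemma euler_measure_integral:
  fixes f :: "real \<Rightarrow> real"
  assumes a: "0 < a" "a < 1" and f [measurable]: "f \<in> borel_measurable borel"
  shows "integrable (euler_measure a) f \<longleftrightarrow>
           set_integrable lborel {0..} (\<lambda>t. complex_of_real (euler_fun a t * f t))"
    and "complex_of_real (\<integral>t. f t \<partial>euler_measure a) =
           (LINT t:{0..}|lborel. complex_of_real (euler_fun a t * f t)) / of_real (Gamma a * Gamma (1 - a))"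
proof -
  note [measurable] = borel_measurable_euler_fun[OF a]
  define c where "c = Gamma a * Gamma (1 - a)"
  have c: "c > 0" unfolding c_def by (rule Gamma_mult_reflection_pos[OF a])
  let ?g = "\<lambda>t. indicator {0..} t * euler_fun a t / c"
  have g: "AE t in lborel. 0 \<le> ?g t" using c euler_fun_nonneg by (intro AE_I2) simp
  have eq: "?g t *\<^sub>R f t = 1 / c * (indicator {0..} t * (euler_fun a t * f t))" for t
    by simp
  have "integrable (euler_measure a) f \<longleftrightarrow> integrable lborel (\<lambda>t. ?g t *\<^sub>R f t)"
    unfolding euler_measure_def c_def[symmetric] by (rule integrable_density) (use g in measurable)
  also have "\<dots> \<longleftrightarrow> integrable lborel (\<lambda>t. indicator {0..} t * (euler_fun a t * f t))"
    unfolding eq using c by (subst integrable_mult_left_iff) simp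
  also have "\<dots> \<longleftrightarrow> integrable lborel (\<lambda>t. complex_of_real (indicator {0..} t * (euler_fun a t * f t)))"
    by (rule complex_of_real_integrable_eq[symmetric])
  finally show "integrable (euler_measure a) f \<longleftrightarrow>
           set_integrable lborel {0..} (\<lambda>t. complex_of_real (euler_fun a t * f t))"
    unfolding set_integrable_def scaleR_conv_of_real of_real_mult .
  have "(\<integral>t. f t \<partial>euler_measure a) = (\<integral>t. ?g t *\<^sub>R f t \<partial>lborel)"
    unfolding euler_measure_def c_def[symmetric] by (rule integral_density) (use g in measurable)
  also have "\<dots> = 1 / c * (\<integral>t. indicator {0..} t * (euler_fun a t * f t) \<partial>lborel)"
    unfolding eq by (rule integral_mult_right_zero)
  finally show "complex_of_real (\<integral>t. f t \<partial>euler_measure a) =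
           (LINT t:{0..}|lborel. complex_of_real (euler_fun a t * f t)) / of_real (Gamma a * Gamma (1 - a))"
    unfolding set_lebesgue_integral_def c_def[symmetric] scaleR_conv_of_real of_real_mult[symmetric]
      integral_complex_of_real by simp
qed

lemma euler_measure_moment:
  assumes a: "0 < a" "a < 1"
  shows "has_bochner_integral (euler_measure a) (\<lambda>t. 1 / (1 + t) ^ Suc n)
           (pochhammer a n * pochhammer (1 - a) n / (fact n)\<^sup>2)"
proof -
  note [measurable] = borel_measurable_euler_fun[OF a]
  define c where "c = Gamma a * Gamma (1 - a)"
  have c: "c > 0" unfolding c_def by (rule Gamma_mult_reflection_pos[OF a])
  let ?g = "\<lambda>t. indicator {0..} t * euler_fun a t / c"
  have pos: "pochhammer a n > 0" "pochhammer (1 - a) n > 0" using a by (auto intro!: pochhammer_pos)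
  have Gamma: "Gamma (a + real n) * Gamma (1 - a + real n) / (fact n)\<^sup>2 =
      c * (pochhammer a n * pochhammer (1 - a) n / (fact n)\<^sup>2)"
    using Gamma_add_nat[of a n] Gamma_add_nat[of "1 - a" n] a by (simp add: c_def mult_ac)
  have "(\<integral>\<^sup>+t. ennreal (indicator {0..} t * (euler_fun a t / (1 + t) ^ Suc n)) \<partial>lborel) =
      ennreal (c * (pochhammer a n * pochhammer (1 - a) n / (fact n)\<^sup>2))"
    unfolding nn_integral_euler_fun_moment[OF a] Gamma ..
  then have "has_bochner_integral lborel (\<lambda>t. indicator {0..} t * (euler_fun a t / (1 + t) ^ Suc n))
      (c * (pochhammer a n * pochhammer (1 - a) n / (fact n)\<^sup>2))"
    using c pos by (intro has_bochner_integral_nn_integral)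
      (auto intro!: AE_I2 simp: euler_fun_nonneg split: split_indicator)
  then have "has_bochner_integral lborel (\<lambda>t. 1 / c * (indicator {0..} t * (euler_fun a t / (1 + t) ^ Suc n)))
      (1 / c * (c * (pochhammer a n * pochhammer (1 - a) n / (fact n)\<^sup>2)))"
    by (rule has_bochner_integral_mult_right)
  then have "has_bochner_integral lborel (\<lambda>t. ?g t *\<^sub>R (1 / (1 + t) ^ Suc n))
      (pochhammer a n * pochhammer (1 - a) n / (fact n)\<^sup>2)"
    using c by (simp del: power_Suc)
  then show ?thesis
    unfolding euler_measure_def c_def[symmetric] using c euler_fun_nonneg
    by (intro has_bochner_integral_density) (auto intro!: AE_I2)
qed

lemma stieltjes_measure_euler_measure:
  assumes a: "0 < a" "a < 1"
  shows "stieltjes_measure (euler_measure a)"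
proof -
  note [measurable] = borel_measurable_euler_fun[OF a]
  have "sigma_finite_measure (euler_measure a)"
    unfolding euler_measure_def
    by (subst sigma_finite_measure.sigma_finite_iff_density_finite[OF sigma_finite_lborel]) auto
  moreover have "sets (euler_measure a) = sets borel"
    by (simp add: euler_measure_def)
  moreover have "AE t in euler_measure a. 0 \<le> t"
    unfolding euler_measure_def
    by (subst AE_density) (auto split: split_indicator_asm intro!: AE_I2)
  moreover have "integrable (euler_measure a) (\<lambda>t. 1 / (1 + t))"
    using euler_measure_moment[OF a, of 0] by (simp add: has_bochner_integral_iff)
  ultimately show ?thesis
    by (simp add: stieltjes_measure_def stieltjes_measure_axioms_def)
qed

text \<open>The self-reproducing property: the discontinuity of \<open>\<^sub>2F\<^sub>1(a, 1 - a; 1; \<cdot>)\<close> across its cut is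
  proportional to the function itself. Near the origin the two sides have equal Taylor coefficients
  by Gauss' theorem.\<close>

lemma stieltjes_euler_measure:
  assumes a: "0 < a" "a < 1" and p: "Re p > -1"
  shows "stieltjes_measure.stieltjes (euler_measure a) p = euler_integral a (- p)"
proof -
  interpret stieltjes_measure "euler_measure a" by (rule stieltjes_measure_euler_measure[OF a])
  have eq: "stieltjes z = euler_integral a (- z)" if "norm z < 1" for z
  proof (rule sums_unique2)
    show "(\<lambda>n. of_real (pochhammer a n * pochhammer (1 - a) n / (fact n)\<^sup>2) * (- z) ^ n) sums euler_integral a (- z)"
      by (rule euler_integral_sums[OF a]) (use that in simp)
    have "(\<integral>t. 1 / (1 + t) ^ Suc n \<partial>euler_measure a) = pochhammer a n * pochhammer (1 - a) n / (fact n)\<^sup>2" for n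
      using euler_measure_moment[OF a, of n] by (simp only: has_bochner_integral_iff)
    with stieltjes_sums[OF that]
    show "(\<lambda>n. of_real (pochhammer a n * pochhammer (1 - a) n / (fact n)\<^sup>2) * (- z) ^ n) sums stieltjes z"
      by (simp only: mult.commute)
  qed
  show ?thesis
  proof (rule analytic_continuation_open[where s="ball 0 1" and s'="{p. Re p > -1}"
        and f=stieltjes and g="\<lambda>p. euler_integral a (- p)"])
    show "ball 0 1 \<subseteq> {p. Re p > -1}"
    proof
      fix z :: complex assume "z \<in> ball 0 1"
      then show "z \<in> {p. Re p > -1}" using abs_Re_le_cmod[of z] by auto
    qed
    show "connected {p. Re p > -1}" by (intro convex_connected convex_halfspace_Re_gt)
    \<comment> \<open>For \<open>Re p > -1\<close> the point \<open>- p\<close> has real part below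
      1 and so avoids the cut.\<close>
    have "euler_integral a \<circ> uminus holomorphic_on {p. Re p > -1}"
      by (rule holomorphic_on_compose_gen[OF _ euler_integral_holomorphic[OF a]])
         (auto intro!: holomorphic_intros simp: complex_eq_iff)
    then show "(\<lambda>p. euler_integral a (- p)) holomorphic_on {p. Re p > -1}" by (simp add: o_def)
  qed (use eq p stieltjes_holomorphic open_halfspace_Re_gt in auto)
qed

section \<open>Specialisation to \<open>a = 1 / 6\<close>\<close>

lemma F_eq_euler_integral:
  assumes "p \<notin> complex_of_real ` {..-1}"
  shows "F p = euler_integral (1 / 6) (- p)"
proof -
  have "- p \<notin> complex_of_real ` {1..}"
  proof
    assume "- p \<in> complex_of_real ` {1..}"
    then obtain r where "- p = of_real r" "r \<ge> 1" by auto
    then have "p = of_real (- r)" "- r \<le> -1" by (metis minus_minus of_real_minus, simp)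
    with assms show False by blast
  qed
  then show ?thesis
    using hyp2F1_eq_euler_integral(2)[of "1 / 6" "- p"] by (simp add: F_def)
qed

lemma F_of_real:
  assumes "t \<ge> 0"
  shows "F (of_real t) = of_real (euler_fun (1 / 6) t)"
proof -
  have "complex_of_real t \<notin> complex_of_real ` {..-1}" using assms by auto
  then show ?thesis
    using F_eq_euler_integral euler_integral_neg_real[of "1 / 6" t] assms by simp
qed

lemma F_analytic: "F analytic_on - (complex_of_real ` {..-1})"
proof -
  have "hyp2F1 (1 / 6) (5 / 6) 1 analytic_on - (complex_of_real ` {1..})"
    using hyp2F1_eq_euler_integral(1)[of "1 / 6"] by simp
  then have "hyp2F1 (1 / 6) (5 / 6) 1 \<circ> uminus analytic_on - (complex_of_real ` {..-1})"
  proof (rule analytic_on_compose_gen[rotated])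
    show "- z \<in> - (complex_of_real ` {1..})" if z: "z \<in> - (complex_of_real ` {..-1})" for z
    proof
      assume "- z \<in> complex_of_real ` {1..}"
      then obtain r where "- z = of_real r" "r \<ge> 1" by auto
      then have "z = of_real (- r)" "- r \<le> -1" by (metis minus_minus of_real_minus, simp)
      with z show False by blast
    qed
  qed (intro analytic_intros)
  then show ?thesis by (simp add: F_def[abs_def] o_def)
qed

text \<open>Euler's reflection formula with \<open>sin (pi / 6) = 1 / 2\<close>; the source of the
  \<open>2 pi\<close> in the denominators of the expansion.\<close>

lemma Gamma_sixth: "Gamma (1 / 6 :: real) * Gamma (1 - 1 / 6) = 2 * pi"
proof -
  have "complex_of_real (Gamma (1 / 6) * Gamma (1 - 1 / 6)) =
      Gamma (complex_of_real (1 / 6)) * Gamma (1 - complex_of_real (1 / 6))"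
    by (simp only: of_real_mult Gamma_complex_of_real[symmetric] of_real_diff of_real_1)
  also have "\<dots> = of_real pi / sin (of_real pi * complex_of_real (1 / 6))"
    by (rule Gamma_reflection_complex)
  also have "\<dots> = of_real (pi / sin (pi * (1 / 6)))"
    by (simp only: of_real_mult[symmetric] sin_of_real of_real_divide[symmetric])
  also have "pi / sin (pi * (1 / 6)) = 2 * pi" by (simp add: sin_30)
  finally show ?thesis by (simp only: of_real_eq_iff)
qed

text \<open>\<open>A\<close>, \<open>B\<close> and \<open>C\<close> name the summands, and the
  shifts \<open>m + 2\<close>, \<open>k + 1\<close> encode the lower limits 2 and 1. Convergence is
  asserted along with the identity because \<open>suminf\<close> and the integral also have values,
  without meaning, when it fails.\<close>

theorem mainTheorem6:
  fixes x :: complex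
  assumes "Re x > 0"
  shows
    "let A = (\<lambda>m::nat. (-1) ^ m * Gamma (of_nat m) / (2 * of_real pi * pochhammer x m) * d m);
         B = (\<lambda>(k::nat) (m::nat).
                Gamma (of_nat m) / (2 * of_real pi * pochhammer (2 ^ k * x) m) * dyadic_d k m);
         C = (\<lambda>k::nat. of_real (exp (1 / 2 ^ k)) * (\<Sum>m. B k (m + 2)))
     in F analytic_on - (complex_of_real ` {..-1}) \<and>
        (\<forall>p. p \<notin> complex_of_real ` {..-1} \<longrightarrow> F p = legendre_P (- 1/6) (1 + 2 * p)) \<and>
        set_integrable lborel {0..} (h_integrand x) \<and>
        (\<forall>m\<ge>2. set_integrable lborel {0..} (d_integrand m)) \<and>
        (\<forall>k\<ge>1. \<forall>m\<ge>2. set_integrable lborel {0..} (dyadic_d_integrand k m)) \<and>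
        summable (\<lambda>m. A (m + 2)) \<and>
        (\<forall>k\<ge>1. summable (\<lambda>m. B k (m + 2))) \<and>
        summable (\<lambda>k. C (k + 1)) \<and>
        h x = F 0 / x - (\<Sum>m. A (m + 2)) - (\<Sum>k. C (k + 1))"
proof -
  have a: "0 < (1 / 6 :: real)" "1 / 6 < (1 :: real)" by auto
  define \<nu> where "\<nu> = euler_measure (1 / 6)"
  interpret S: stieltjes_measure \<nu>
    unfolding \<nu>_def by (rule stieltjes_measure_euler_measure[OF a])
  define A where "A = (\<lambda>m::nat. (-1) ^ m * Gamma (of_nat m) / (2 * of_real pi * pochhammer x m) * d m)"
  define B where "B = (\<lambda>(k::nat) (m::nat).
                Gamma (of_nat m) / (2 * of_real pi * pochhammer (2 ^ k * x) m) * dyadic_d k m)"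
  define C where "C = (\<lambda>k::nat. of_real (exp (1 / 2 ^ k)) * (\<Sum>m. B k (m + 2)))"
  define D where "D = (\<lambda>\<epsilon> l m t. exp ((1 + t) / l) / (exp ((1 + t) / l) - \<epsilon>) ^ m :: real)"
  have D_meas [measurable]: "D \<epsilon> l m \<in> borel_measurable borel" for \<epsilon> l m
    unfolding D_def by measurable
  have Gamma_nat: "Gamma (of_nat (i + 2)) = (fact (Suc i) :: complex)" for i
    using Gamma_fact[of "Suc i", where 'a=complex] by (simp add: algebra_simps)

  have F_st: "F (of_real p) = S.stieltjes (of_real p)" if "p \<ge> 0" for p
  proof -
    have "complex_of_real p \<notin> complex_of_real ` {..-1}" using that by auto
    then show ?thesis
      using F_eq_euler_integral stieltjes_euler_measure[OF a, of "of_real p"] that by (simp add: \<nu>_def)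
  qed
  have F0: "F 0 = S.stieltjes 0"
    using F_st[of 0] by simp

  have h: "h x = F 0 / x - S.defect x (\<lambda>y. 1 / y)"
  proof -
    have "h x = (\<integral>p. indicator {0..} p *\<^sub>R exp (- complex_of_real p * x) * S.stieltjes (of_real p) \<partial>lborel)"
      unfolding h_def set_lebesgue_integral_def
    proof (rule Bochner_Integration.integral_cong[OF refl])
      fix p :: real
      show "indicator {0..} p *\<^sub>R h_integrand x p =
          indicator {0..} p *\<^sub>R exp (- complex_of_real p * x) * S.stieltjes (of_real p)"
        using F_st[of p] by (cases "p \<ge> 0") (simp_all add: h_integrand_def)
    qed
    then show ?thesis using S.laplace_stieltjes[OF assms] F0 by simp
  qed

  have h_int: "set_integrable lborel {0..} (h_integrand x)"
    unfolding set_integrable_def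
  proof (rule Bochner_Integration.integrable_bound[OF integrable_laplace_kernel[OF assms]])
    have eq: "indicator {0..} p *\<^sub>R h_integrand x p =
        indicator {0..} p *\<^sub>R exp (- complex_of_real p * x) * of_real (euler_fun (1 / 6) p)" for p
      by (cases "p \<ge> 0") (simp_all add: h_integrand_def F_of_real)
    note [measurable] = borel_measurable_euler_fun[OF a]
    show "(\<lambda>p. indicator {0..} p *\<^sub>R h_integrand x p) \<in> borel_measurable lborel"
      unfolding eq by measurable
    have "norm (indicator {0..} p *\<^sub>R h_integrand x p) \<le> norm (indicator {0..} p *\<^sub>R exp (- complex_of_real p * x))" for p
    proof (cases "p \<ge> 0")
      case True
      then have "\<bar>euler_fun (1 / 6) p\<bar> \<le> 1"
        using euler_fun_nonneg[of "1/6" p] euler_fun_le_1[OF a True] by simp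
      then show ?thesis unfolding eq norm_mult norm_of_real by (intro mult_left_le) auto
    qed simp
    then show "AE p in lborel. norm (indicator {0..} p *\<^sub>R h_integrand x p) \<le>
        norm (indicator {0..} p *\<^sub>R exp (- complex_of_real p * x))"
      by (rule AE_I2)
  qed

  have d_eq: "indicator {0..} t *\<^sub>R d_integrand m t =
      indicator {0..} t *\<^sub>R complex_of_real (euler_fun (1 / 6) t * D 1 1 m t)" for m t
    by (cases "t \<ge> 0") (simp_all add: d_integrand_def D_def F_of_real add.commute)
  \<comment> \<open>The factor \<open>exp (2 powr (- k))\<close> in front of the inner series arises
    here: the measure carries \<open>exp ((1 + t) / 2 ^ k)\<close>, while \<open>dyadic_d\<close>
    keeps only \<open>exp (t / 2 ^ k)\<close>.\<close>
  have dyadic_eq: "indicator {0..} t *\<^sub>R complex_of_real (euler_fun (1 / 6) t * D (- 1) (2 ^ k) m t) =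
      of_real (exp (1 / 2 ^ k)) * (indicator {0..} t *\<^sub>R dyadic_d_integrand k m t)" for k m t
  proof (cases "t \<ge> 0")
    case True
    have "exp ((1 + t) / 2 ^ k) = exp (1 / 2 ^ k) * exp (t / 2 ^ k)"
      by (simp add: add_divide_distrib exp_add)
    then have "D (- 1) (2 ^ k) m t = exp (1 / 2 ^ k) * exp (t / 2 ^ k) / (exp ((1 + t) / 2 ^ k) + 1) ^ m"
      by (simp add: D_def)
    then show ?thesis using True by (simp add: dyadic_d_integrand_def F_of_real)
  qed simp

  \<comment> \<open>The quadratic Taylor bound \<open>1 + 1 + 1 / 2\<close> gives both
    \<open>exp 1 - 1 \<ge> 3 / 2\<close>, the ratio constant \<open>c\<close>, and
    \<open>exp 1 \<ge> 2\<close>.\<close>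
  have exp1: "exp (1 :: real) \<ge> 5 / 2"
    using exp_lower_Taylor_quadratic[of 1] by simp
  have dk0: "integrable \<nu> (D 1 1 (i + 2))"
    and dk0': "(\<lambda>i. (- of_real 1) ^ (i + 2) * fact (Suc i) / pochhammer (of_real 1 * x) (i + 2) *
            of_real (\<integral>t. D 1 1 (i + 2) t \<partial>\<nu>)) sums S.defect x (dyadic_kernel 1 1)" for i
    unfolding D_def using exp1
    by (intro S.defect_dyadic_kernel_sums[OF assms, where c="3 / 2"]; simp)+
  have exp_ge: "- 2 \<le> exp (1 / 2 ^ k :: real)" for k :: nat
    by (rule order_trans[OF _ exp_ge_zero]) simp
  \<comment> \<open>For \<open>\<epsilon> = -1\<close> the choice \<open>c = 2\<close> works at
    every scale, since \<open>exp (1 / 2 ^ k) + 1 \<ge> 2\<close>; the powers of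
    \<open>- \<epsilon>\<close> are 1, so no sign alternates.\<close>
  have dk: "integrable \<nu> (D (- 1) (2 ^ k) (i + 2))"
    and dk': "(\<lambda>i. (- of_real (- 1)) ^ (i + 2) * fact (Suc i) / pochhammer (of_real (2 ^ k) * x) (i + 2) *
            of_real (\<integral>t. D (- 1) (2 ^ k) (i + 2) t \<partial>\<nu>)) sums S.defect x (dyadic_kernel (- 1) (2 ^ k))" for i k
    unfolding D_def
    by (intro S.defect_dyadic_kernel_sums[OF assms, where c="2"]; simp add: exp_ge)+

  have d_int: "set_integrable lborel {0..} (d_integrand m)" if "m \<ge> 2" for m
  proof -
    have "integrable \<nu> (D 1 1 m)" using dk0[of "m - 2"] unfolding le_add_diff_inverse2[OF that] .
    then have "set_integrable lborel {0..} (\<lambda>t. complex_of_real (euler_fun (1 / 6) t * D 1 1 m t))"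
      unfolding \<nu>_def by (subst (asm) euler_measure_integral(1)[OF a D_meas])
    then show ?thesis unfolding set_integrable_def d_eq .
  qed
  have dyadic_int: "set_integrable lborel {0..} (dyadic_d_integrand k m)" if "m \<ge> 2" for k m
  proof -
    have "integrable \<nu> (D (- 1) (2 ^ k) m)" using dk[of k "m - 2"] unfolding le_add_diff_inverse2[OF that] .
    then have "set_integrable lborel {0..} (\<lambda>t. complex_of_real (euler_fun (1 / 6) t * D (- 1) (2 ^ k) m t))"
      unfolding \<nu>_def by (subst (asm) euler_measure_integral(1)[OF a D_meas])
    then have "integrable lborel (\<lambda>t. 1 / of_real (exp (1 / 2 ^ k)) *
        (of_real (exp (1 / 2 ^ k)) * (indicator {0..} t *\<^sub>R dyadic_d_integrand k m t)))"
      unfolding set_integrable_def dyadic_eq by (rule integrable_mult_right)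
    then show ?thesis unfolding set_integrable_def by simp
  qed
  have d_val: "of_real (\<integral>t. D 1 1 m t \<partial>\<nu>) = d m / (2 * of_real pi)" for m
    unfolding \<nu>_def euler_measure_integral(2)[OF a D_meas] Gamma_sixth d_def set_lebesgue_integral_def d_eq
    by simp
  have dyadic_val: "of_real (\<integral>t. D (- 1) (2 ^ k) m t \<partial>\<nu>) =
      of_real (exp (1 / 2 ^ k)) * dyadic_d k m / (2 * of_real pi)" for k m
    unfolding \<nu>_def euler_measure_integral(2)[OF a D_meas] Gamma_sixth dyadic_d_def
      set_lebesgue_integral_def dyadic_eq integral_mult_right_zero
    by simp

  have A_sums: "(\<lambda>m. A (m + 2)) sums S.defect x (dyadic_kernel 1 1)"
    using dk0' unfolding d_val A_def Gamma_nat by (simp add: mult_ac)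
  have B_sums: "(\<lambda>m. B k (m + 2)) sums (S.defect x (dyadic_kernel (- 1) (2 ^ k)) / of_real (exp (1 / 2 ^ k)))" for k
  proof -
    have "(\<lambda>m. of_real (exp (1 / 2 ^ k)) * B k (m + 2)) sums S.defect x (dyadic_kernel (- 1) (2 ^ k))"
      using dk'[of k] unfolding dyadic_val B_def Gamma_nat by (simp add: mult_ac)
    from sums_divide[OF this, of "of_real (exp (1 / 2 ^ k))"] show ?thesis by simp
  qed
  \<comment> \<open>The prefactor in \<open>C\<close> cancels the division in \<open>B_sums\<close>,
    leaving exactly the defect of the \<open>k\<close>-th kernel, to which the dyadic summation
    applies.\<close>
  have C: "C k = S.defect x (dyadic_kernel (- 1) (2 ^ k))" for k
    unfolding C_def sums_unique[OF B_sums, symmetric] by simp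
  have C_sums: "(\<lambda>k. C (k + 1)) sums (S.defect x (\<lambda>y. 1 / y) - S.defect x (dyadic_kernel 1 1))"
    using S.defect_dyadic_sums[OF assms] unfolding C by simp
  have leg: "F p = legendre_P (- 1/6) (1 + 2 * p)" for p
    by (simp add: F_def legendre_P_def)
  have h_eq: "h x = F 0 / x - (\<Sum>m. A (m + 2)) - (\<Sum>k. C (k + 1))"
    unfolding h sums_unique[OF A_sums, symmetric] sums_unique[OF C_sums, symmetric] by simp
  have "F analytic_on - (complex_of_real ` {..-1}) \<and>
        (\<forall>p. p \<notin> complex_of_real ` {..-1} \<longrightarrow> F p = legendre_P (- 1/6) (1 + 2 * p)) \<and>
        set_integrable lborel {0..} (h_integrand x) \<and>
        (\<forall>m\<ge>2. set_integrable lborel {0..} (d_integrand m)) \<and>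
        (\<forall>k\<ge>1. \<forall>m\<ge>2. set_integrable lborel {0..} (dyadic_d_integrand k m)) \<and>
        summable (\<lambda>m. A (m + 2)) \<and>
        (\<forall>k\<ge>1. summable (\<lambda>m. B k (m + 2))) \<and>
        summable (\<lambda>k. C (k + 1)) \<and>
        h x = F 0 / x - (\<Sum>m. A (m + 2)) - (\<Sum>k. C (k + 1))"
    by (intro conjI allI impI F_analytic leg h_int d_int dyadic_int h_eq
        sums_summable[OF A_sums] sums_summable[OF B_sums] sums_summable[OF C_sums])
  then show ?thesis
    unfolding A_def B_def C_def Let_def .
qed

end
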